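(* Let $\Omega$ be a weighted simplicial complex on $[n]$ with an action of the finite group $G$, and let $p\in\mathcal P=\mathbb R[\mathbf x^{[0]},\dots,\mathbf x^{[n]}]$. (i) $\operatorname{rank}_{(\Omega,G)}(p)\le\operatorname{sep-rank}_{(\Omega,G)}(p)$, where the separable rank is taken with respect to any local convex cones $\mathcal C^{[i]}\subseteq\mathbb R[\mathbf x^{[i]}]$ satisfying $\mathcal C^{[i]}=\mathcal C^{[gi]}$ for all $g\in G$. (ii) $\operatorname{rank}_{(\Omega,G)}(p)\le\operatorname{sos-rank}_{(\Omega,G)}(p)^2$. (iii) If $(\Omega,G)$ is factorizable, then $\operatorname{sos-rank}_{(\Omega,G)}(p)\le\operatorname{sep-rank}_{(\Omega,G)}(p)$, where the separable rank is taken with respect to the local cones of sum-of-squares polynomials. (iv) If $\Omega$ is connected, the action of $G$ on $\Omega$ is free, $(\Omega,G)$ is factorizable, and $p$ is $G$-invariant, then $\operatorname{sos-rank}_{(\Omega,G)}(p)\le|G|\cdot\operatorname{sep-rank}_\Omega(p)$, where the separable rank is taken with respect to the local cones of sum-of-squares polynomials.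
   Context: $[n]=\{0,\dots,n\}$ and $\mathbb N=\{0,1,2,\dots\}$. A weighted simplicial complex on $[n]$ is a map $\Omega$ from the power set of $[n]$ to $\mathbb N$ such that $\Omega(S_1)$ divides $\Omega(S_2)$ whenever $S_1\subseteq S_2$; it is always assumed that $\Omega(\{i\})\neq 0$ for all $i\in[n]$. Sets $S$ with $\Omega(S)\ne0$ are called simplices, inclusion-maximal simplices are called facets, and $\mathcal F$ is the set of facets. $\widetilde{\mathcal F}$ is the multiset containing each facet $F$ exactly $\Omega(F)$ times (copies are regarded as distinct elements), $c:\widetilde{\mathcal F}\to\mathcal F$ maps each copy to its underlying facet, and $\widetilde{\mathcal F}_i=\{\mathfrak f\in\widetilde{\mathcal F}: i\in c(\mathfrak f)\}$. Two vertices are neighbours if some facet contains both; $\Omega$ is connected if any two vertices are joined by a chain of consecutive neighbours. An action of a finite group $G$ on $\Omega$ consists of an action of $G$ on $[n]$ with $\Omega(gS)=\Omega(S)$ for all $g\in G$, $S\subseteq[n]$, together with an action of $G$ on the set $\widetilde{\mathcal F}$ such that $c(g\mathfrak f)=g\,c(\mathfrak f)$. The action on $\Omega$ is called free if the action on $\widetilde{\mathcal F}$ is free (all stabilizers are trivial). For each $i\in[n]$, $\mathbf x^{[i]}=(x^{[i]}_1,\dots,x^{[i]}_{m_i})$ is a collection of variables, with $m_i=m_{gi}$ for all $g\in G$. If $m_i=m_j$ and $f\in\mathbb R[\mathbf x^{[i]}]$, then $f(\mathbf x^{[j]})$ denotes the polynomial obtained by substituting $\mathbf x^{[j]}$ for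 $\mathbf x^{[i]}$. $G$ acts on $\mathcal P$ by $(gp)(\mathbf x^{[0]},\dots,\mathbf x^{[n]})=p(\mathbf x^{[g0]},\dots,\mathbf x^{[gn]})$, and $p$ is $G$-invariant if $gp=p$ for all $g\in G$. For sets $A,\mathcal I$, $\mathcal I^A$ denotes the set of functions $A\to\mathcal I$. For $\alpha\in\mathcal I^{\widetilde{\mathcal F}}$, $\alpha_{|_i}$ is its restriction to $\widetilde{\mathcal F}_i$. For $g\in G$ and $\beta\in\mathcal I^{\widetilde{\mathcal F}_i}$ (resp. $\gamma\in\mathcal I^{\widetilde{\mathcal F}}$), ${}^g\beta\in\mathcal I^{\widetilde{\mathcal F}_{gi}}$ (resp. ${}^g\gamma\in\mathcal I^{\widetilde{\mathcal F}}$) is defined by $({}^g\beta)(\mathfrak f)=\beta(g^{-1}\mathfrak f)$ (resp. $({}^g\gamma)(\mathfrak f)=\gamma(g^{-1}\mathfrak f)$). An $(\Omega,G)$-decomposition of $p$ consists of a finite index set $\mathcal I$ and local polynomials $p^{[i]}_\beta\in\mathbb R[\mathbf x^{[i]}]$ for $i\in[n]$, $\beta\in\mathcal I^{\widetilde{\mathcal F}_i}$, such that $$p=\sum_{\alpha\in\mathcal I^{\widetilde{\mathcal F}}}p^{[0]}_{\alpha_{|_0}}(\mathbf x^{[0]})\cdots p^{[n]}_{\alpha_{|_n}}(\mathbf x^{[n]})$$ and $p^{[i]}_\beta(\mathbf x^{[i]})=p^{[gi]}_{{}^g\beta}(\mathbf x^{[i]})$ for all $i\in[n]$, $g\in G$,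 $\beta\in\mathcal I^{\widetilde{\mathcal F}_i}$. It is separable (with respect to given local convex cones $\mathcal C^{[i]}$) if all $p^{[i]}_\beta\in\mathcal C^{[i]}$. $\operatorname{rank}_{(\Omega,G)}(p)$ (resp. $\operatorname{sep-rank}_{(\Omega,G)}(p)$) is the minimal cardinality of $\mathcal I$ among all $(\Omega,G)$-decompositions (resp. separable $(\Omega,G)$-decompositions) of $p$, and $\infty$ if there is none. $\operatorname{sep-rank}_\Omega$ denotes the case of the trivial group. Let $\mathfrak q=(q_{\mathbf k})_{\mathbf k\in\mathcal S}$ be a family in $\mathcal P$ indexed by $\mathcal S=\mathcal S_0\times\cdots\times\mathcal S_n$ with finite sets $\mathcal S_i$ satisfying $\mathcal S_i=\mathcal S_{gi}$ for all $g\in G$. An $(\Omega,G)$-decomposition of $\mathfrak q$ consists of a finite index set $\mathcal I$ and polynomials $q^{[i]}_{k,\beta}\in\mathbb R[\mathbf x^{[i]}]$ for $i\in[n]$, $k\in\mathcal S_i$, $\beta\in\mathcal I^{\widetilde{\mathcal F}_i}$ such that $q_{\mathbf k}=\sum_{\alpha\in\mathcal I^{\widetilde{\mathcal F}}}q^{[0]}_{k_0,\alpha_{|_0}}(\mathbf x^{[0]})\cdots q^{[n]}_{k_n,\alpha_{|_n}}(\mathbf x^{[n]})$ for every $\mathbf k\in\mathcal S$, and $q^{[i]}_{k,\beta}(\mathbf x^{[i]})=q^{[gi]}_{k,{}^g\beta}(\mathbf x^{[i]})$ for all $i,k,\beta,g$. An sos $(\Omega,G)$-decomposition of $p$ is such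 a family with $p=\sum_{\mathbf k\in\mathcal S}q_{\mathbf k}^2$ together with an $(\Omega,G)$-decomposition of it; $\operatorname{sos-rank}_{(\Omega,G)}(p)$ is the minimal $|\mathcal I|$ among all sos $(\Omega,G)$-decompositions of $p$ ($\infty$ if there is none). $(\Omega,G)$ is called factorizable if for each finite index set $\mathcal I$ there are real numbers $C^{[i]}_\beta>0$ ($i\in[n]$, $\beta\in\mathcal I^{\widetilde{\mathcal F}_i}$) with $C^{[gi]}_{{}^g\beta}=C^{[i]}_\beta$ for all $i,\beta,g$ and $$C^{[0]}_{\alpha_{|_0}}\cdot C^{[1]}_{\alpha_{|_1}}\cdots C^{[n]}_{\alpha_{|_n}}=K_\alpha^{-1}\quad\text{for all }\alpha\in\mathcal I^{\widetilde{\mathcal F}},$$ where $K_\alpha=\big|\{\gamma\in\mathcal I^{\widetilde{\mathcal F}}:\exists\,g_0,\dots,g_n\in G\text{ with }g_ii=i\text{ and }({}^{g_i}\gamma)_{|_i}=\alpha_{|_i}\text{ for all }i\in[n]\}\big|$. *)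

theory Defs
  imports
    "HOL-Algebra.Group_Action"
    "HOL-Algebra.Elementary_Groups"
    "HOL-Library.Poly_Mapping"
    "HOL-Library.Extended_Nat"
    "HOL-Library.FuncSet"
    Complex_Main
begin

section \<open>Real polynomials in the variables \<open>x\<^sup>[\<^sup>i\<^sup>]\<^sub>j\<close>\<close>

text \<open>
  The pair \<open>(i, j)\<close> stands for the \<open>j\<close>-th variable (counted from 0) of the collection at
  vertex \<open>i\<close>. A polynomial is the finitely supported map from monomials to coefficients.
\<close>

type_synonym rpoly = "(nat \<times> nat \<Rightarrow>\<^sub>0 nat) \<Rightarrow>\<^sub>0 real"

definition PConst :: "real \<Rightarrow> rpoly" where
  "PConst c = Poly_Mapping.single 0 c"

definition PVar :: "nat \<times> nat \<Rightarrow> rpoly" where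
  "PVar v = Poly_Mapping.single (Poly_Mapping.single v 1) 1"

definition polys_in :: "(nat \<times> nat) set \<Rightarrow> rpoly set" where
  "polys_in V = {p. \<forall>t \<in> Poly_Mapping.keys p. Poly_Mapping.keys t \<subseteq> V}"

definition local_polys :: "(nat \<Rightarrow> nat) \<Rightarrow> nat \<Rightarrow> rpoly set" where
  "local_polys m i = polys_in ({i} \<times> {..<m i})"

definition global_polys :: "nat \<Rightarrow> (nat \<Rightarrow> nat) \<Rightarrow> rpoly set" where
  "global_polys n m = polys_in (SIGMA i:{0..n}. {..<m i})"

definition poly_subst :: "(nat \<times> nat \<Rightarrow> rpoly) \<Rightarrow> rpoly \<Rightarrow> rpoly" where
  "poly_subst s p = (\<Sum>t \<in> Poly_Mapping.keys p. PConst (Poly_Mapping.lookup p t) *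
     (\<Prod>v \<in> Poly_Mapping.keys t. s v ^ Poly_Mapping.lookup t v))"

text \<open>
  For \<open>f\<close> in the variables of a single vertex, \<open>at_vertex j f\<close> is \<open>f(x\<^sup>[\<^sup>j\<^sup>])\<close>; the vertex that
  the variables of \<open>f\<close> belong to need not be named.
\<close>

definition at_vertex :: "nat \<Rightarrow> rpoly \<Rightarrow> rpoly" where
  "at_vertex j f = poly_subst (\<lambda>(_, k). PVar (j, k)) f"

definition poly_convex_cone :: "rpoly set \<Rightarrow> bool" where
  "poly_convex_cone C \<longleftrightarrow> C \<noteq> {} \<and>
     (\<forall>f \<in> C. \<forall>h \<in> C. \<forall>a \<ge> 0. \<forall>b \<ge> 0. PConst a * f + PConst b * h \<in> C)"

definition sos_cone :: "(nat \<Rightarrow> nat) \<Rightarrow> nat \<Rightarrow> rpoly set" where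
  "sos_cone m i = {\<Sum>k<N. (h k)\<^sup>2 | (N::nat) h. \<forall>k<N. h k \<in> local_polys m i}"


section \<open>Weighted simplicial complexes and group actions\<close>

locale weighted_simplicial_complex =
  fixes n :: nat and \<Omega> :: "nat set \<Rightarrow> nat"
  assumes weight_dvd: "\<lbrakk>S1 \<subseteq> S2; S2 \<subseteq> {0..n}\<rbrakk> \<Longrightarrow> \<Omega> S1 dvd \<Omega> S2"
    and weight_vertex: "i \<in> {0..n} \<Longrightarrow> \<Omega> {i} \<noteq> 0"

definition simplices :: "nat \<Rightarrow> (nat set \<Rightarrow> nat) \<Rightarrow> nat set set" where
  "simplices n \<Omega> = {S. S \<subseteq> {0..n} \<and> \<Omega> S \<noteq> 0}"

definition facets :: "nat \<Rightarrow> (nat set \<Rightarrow> nat) \<Rightarrow> nat set set" where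
  "facets n \<Omega> = {F \<in> simplices n \<Omega>. \<forall>S \<in> simplices n \<Omega>. F \<subseteq> S \<longrightarrow> S = F}"

text \<open>
  The multiset of facets, its copies being told apart by a number: \<open>(F, k)\<close> is the \<open>k\<close>-th copy
  of \<open>F\<close>, and \<^const>\<open>fst\<close> is the map \<open>c\<close> from copies to facets.
\<close>

type_synonym facet_copy = "nat set \<times> nat"

definition facet_copies :: "nat \<Rightarrow> (nat set \<Rightarrow> nat) \<Rightarrow> facet_copy set" where
  "facet_copies n \<Omega> = (SIGMA F:facets n \<Omega>. {..<\<Omega> F})"

definition facet_copies_at :: "nat \<Rightarrow> (nat set \<Rightarrow> nat) \<Rightarrow> nat \<Rightarrow> facet_copy set" where
  "facet_copies_at n \<Omega> i = {f \<in> facet_copies n \<Omega>. i \<in> fst f}"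

definition neighbours :: "nat \<Rightarrow> (nat set \<Rightarrow> nat) \<Rightarrow> nat \<Rightarrow> nat \<Rightarrow> bool" where
  "neighbours n \<Omega> i j \<longleftrightarrow> (\<exists>F \<in> facets n \<Omega>. i \<in> F \<and> j \<in> F)"

definition complex_connected :: "nat \<Rightarrow> (nat set \<Rightarrow> nat) \<Rightarrow> bool" where
  "complex_connected n \<Omega> \<longleftrightarrow> (\<forall>i \<in> {0..n}. \<forall>j \<in> {0..n}. (neighbours n \<Omega>)\<^sup>*\<^sup>* i j)"

text \<open>\<open>\<rho>\<close> is the action on the vertices, \<open>\<sigma>\<close> the action on the copies of the facets.\<close>

locale complex_action =
  weighted_simplicial_complex n \<Omega> +
  vertices: group_action G "{0..n}" \<rho> +
  copies: group_action G "facet_copies n \<Omega>" \<sigma>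
  for n :: nat and \<Omega> :: "nat set \<Rightarrow> nat" and G :: "('g, 'b) monoid_scheme" (structure)
    and \<rho> :: "'g \<Rightarrow> nat \<Rightarrow> nat" and \<sigma> :: "'g \<Rightarrow> facet_copy \<Rightarrow> facet_copy" +
  assumes finite_group: "finite (carrier G)"
    and weight_invariant:
      "\<lbrakk>g \<in> carrier G; S \<subseteq> {0..n}\<rbrakk> \<Longrightarrow> \<Omega> (\<rho> g ` S) = \<Omega> S"
    and copy_equivariant:
      "\<lbrakk>g \<in> carrier G; f \<in> facet_copies n \<Omega>\<rbrakk> \<Longrightarrow> fst (\<sigma> g f) = \<rho> g ` fst f"

definition free_action ::
  "nat \<Rightarrow> (nat set \<Rightarrow> nat) \<Rightarrow> ('g, 'b) monoid_scheme \<Rightarrow> ('g \<Rightarrow> facet_copy \<Rightarrow> facet_copy) \<Rightarrow> bool"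
  where
  "free_action n \<Omega> G \<sigma> \<longleftrightarrow> (\<forall>f \<in> facet_copies n \<Omega>. stabilizer G \<sigma> f = {\<one>\<^bsub>G\<^esub>})"

definition poly_invariant ::
  "('g, 'b) monoid_scheme \<Rightarrow> ('g \<Rightarrow> nat \<Rightarrow> nat) \<Rightarrow> rpoly \<Rightarrow> bool" where
  "poly_invariant G \<rho> p \<longleftrightarrow>
     (\<forall>g \<in> carrier G. poly_subst (\<lambda>(i, k). PVar (\<rho> g i, k)) p = p)"

text \<open>
  Functions \<open>A \<rightarrow> I\<close> are the extensional ones in \<open>A \<rightarrow>\<^sub>E I\<close>. In \<open>translate G \<sigma> g B \<beta>\<close>, which is
  \<open>\<beta> \<circ> g\<inverse>\<close>, the set \<open>B\<close> is the domain of the result: all copies for a function on all copies,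
  and the copies at \<open>g i\<close> for a function on the copies at \<open>i\<close>.
\<close>

definition translate ::
  "('g, 'b) monoid_scheme \<Rightarrow> ('g \<Rightarrow> facet_copy \<Rightarrow> facet_copy) \<Rightarrow> 'g \<Rightarrow> facet_copy set \<Rightarrow>
   (facet_copy \<Rightarrow> nat) \<Rightarrow> facet_copy \<Rightarrow> nat" where
  "translate G \<sigma> g B \<beta> = (\<lambda>f\<in>B. \<beta> (\<sigma> (inv\<^bsub>G\<^esub> g) f))"


section \<open>Decompositions and ranks\<close>

text \<open>
  The index sets \<open>I\<close> and \<open>S i\<close> are finite sets of natural numbers; every finite set is in bijection
  with such a set. As \<open>Inf {} = \<infinity>\<close> in \<^typ>\<open>enat\<close>, the ranks are infinite when there is no
  decomposition.
\<close>

definition decomposition ::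
  "nat \<Rightarrow> (nat set \<Rightarrow> nat) \<Rightarrow> ('g, 'b) monoid_scheme \<Rightarrow> ('g \<Rightarrow> nat \<Rightarrow> nat) \<Rightarrow>
   ('g \<Rightarrow> facet_copy \<Rightarrow> facet_copy) \<Rightarrow> (nat \<Rightarrow> nat) \<Rightarrow> rpoly \<Rightarrow>
   nat set \<Rightarrow> (nat \<Rightarrow> (facet_copy \<Rightarrow> nat) \<Rightarrow> rpoly) \<Rightarrow> bool" where
  "decomposition n \<Omega> G \<rho> \<sigma> m p I P \<longleftrightarrow>
     finite I \<and>
     (\<forall>i \<in> {0..n}. \<forall>\<beta> \<in> facet_copies_at n \<Omega> i \<rightarrow>\<^sub>E I. P i \<beta> \<in> local_polys m i) \<and>
     p = (\<Sum>\<alpha> \<in> facet_copies n \<Omega> \<rightarrow>\<^sub>E I. \<Prod>i\<in>{0..n}. P i (restrict \<alpha> (facet_copies_at n \<Omega> i))) \<and>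
     (\<forall>i \<in> {0..n}. \<forall>g \<in> carrier G. \<forall>\<beta> \<in> facet_copies_at n \<Omega> i \<rightarrow>\<^sub>E I.
        P i \<beta> = at_vertex i (P (\<rho> g i) (translate G \<sigma> g (facet_copies_at n \<Omega> (\<rho> g i)) \<beta>)))"

definition separable_decomposition ::
  "nat \<Rightarrow> (nat set \<Rightarrow> nat) \<Rightarrow> ('g, 'b) monoid_scheme \<Rightarrow> ('g \<Rightarrow> nat \<Rightarrow> nat) \<Rightarrow>
   ('g \<Rightarrow> facet_copy \<Rightarrow> facet_copy) \<Rightarrow> (nat \<Rightarrow> nat) \<Rightarrow> (nat \<Rightarrow> rpoly set) \<Rightarrow> rpoly \<Rightarrow>
   nat set \<Rightarrow> (nat \<Rightarrow> (facet_copy \<Rightarrow> nat) \<Rightarrow> rpoly) \<Rightarrow> bool" where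
  "separable_decomposition n \<Omega> G \<rho> \<sigma> m C p I P \<longleftrightarrow>
     decomposition n \<Omega> G \<rho> \<sigma> m p I P \<and>
     (\<forall>i \<in> {0..n}. \<forall>\<beta> \<in> facet_copies_at n \<Omega> i \<rightarrow>\<^sub>E I. P i \<beta> \<in> C i)"

definition family_decomposition ::
  "nat \<Rightarrow> (nat set \<Rightarrow> nat) \<Rightarrow> ('g, 'b) monoid_scheme \<Rightarrow> ('g \<Rightarrow> nat \<Rightarrow> nat) \<Rightarrow>
   ('g \<Rightarrow> facet_copy \<Rightarrow> facet_copy) \<Rightarrow> (nat \<Rightarrow> nat) \<Rightarrow> (nat \<Rightarrow> nat set) \<Rightarrow> ((nat \<Rightarrow> nat) \<Rightarrow> rpoly) \<Rightarrow>
   nat set \<Rightarrow> (nat \<Rightarrow> nat \<Rightarrow> (facet_copy \<Rightarrow> nat) \<Rightarrow> rpoly) \<Rightarrow> bool" where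
  "family_decomposition n \<Omega> G \<rho> \<sigma> m S q I Q \<longleftrightarrow>
     finite I \<and>
     (\<forall>i \<in> {0..n}. \<forall>k \<in> S i. \<forall>\<beta> \<in> facet_copies_at n \<Omega> i \<rightarrow>\<^sub>E I. Q i k \<beta> \<in> local_polys m i) \<and>
     (\<forall>ks \<in> Pi\<^sub>E {0..n} S.
        q ks = (\<Sum>\<alpha> \<in> facet_copies n \<Omega> \<rightarrow>\<^sub>E I.
                  \<Prod>i\<in>{0..n}. Q i (ks i) (restrict \<alpha> (facet_copies_at n \<Omega> i)))) \<and>
     (\<forall>i \<in> {0..n}. \<forall>k \<in> S i. \<forall>g \<in> carrier G. \<forall>\<beta> \<in> facet_copies_at n \<Omega> i \<rightarrow>\<^sub>E I.
        Q i k \<beta> = at_vertex i (Q (\<rho> g i) k (translate G \<sigma> g (facet_copies_at n \<Omega> (\<rho> g i)) \<beta>)))"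

definition sos_decomposition ::
  "nat \<Rightarrow> (nat set \<Rightarrow> nat) \<Rightarrow> ('g, 'b) monoid_scheme \<Rightarrow> ('g \<Rightarrow> nat \<Rightarrow> nat) \<Rightarrow>
   ('g \<Rightarrow> facet_copy \<Rightarrow> facet_copy) \<Rightarrow> (nat \<Rightarrow> nat) \<Rightarrow> rpoly \<Rightarrow>
   (nat \<Rightarrow> nat set) \<Rightarrow> ((nat \<Rightarrow> nat) \<Rightarrow> rpoly) \<Rightarrow>
   nat set \<Rightarrow> (nat \<Rightarrow> nat \<Rightarrow> (facet_copy \<Rightarrow> nat) \<Rightarrow> rpoly) \<Rightarrow> bool" where
  "sos_decomposition n \<Omega> G \<rho> \<sigma> m p S q I Q \<longleftrightarrow>
     (\<forall>i \<in> {0..n}. finite (S i)) \<and>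
     (\<forall>i \<in> {0..n}. \<forall>g \<in> carrier G. S (\<rho> g i) = S i) \<and>
     (\<forall>ks \<in> Pi\<^sub>E {0..n} S. q ks \<in> global_polys n m) \<and>
     p = (\<Sum>ks \<in> Pi\<^sub>E {0..n} S. (q ks)\<^sup>2) \<and>
     family_decomposition n \<Omega> G \<rho> \<sigma> m S q I Q"

definition rank_action ::
  "nat \<Rightarrow> (nat set \<Rightarrow> nat) \<Rightarrow> ('g, 'b) monoid_scheme \<Rightarrow> ('g \<Rightarrow> nat \<Rightarrow> nat) \<Rightarrow>
   ('g \<Rightarrow> facet_copy \<Rightarrow> facet_copy) \<Rightarrow> (nat \<Rightarrow> nat) \<Rightarrow> rpoly \<Rightarrow> enat" where
  "rank_action n \<Omega> G \<rho> \<sigma> m p =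
     Inf {enat (card I) | I. \<exists>P. decomposition n \<Omega> G \<rho> \<sigma> m p I P}"

definition sep_rank_action ::
  "nat \<Rightarrow> (nat set \<Rightarrow> nat) \<Rightarrow> ('g, 'b) monoid_scheme \<Rightarrow> ('g \<Rightarrow> nat \<Rightarrow> nat) \<Rightarrow>
   ('g \<Rightarrow> facet_copy \<Rightarrow> facet_copy) \<Rightarrow> (nat \<Rightarrow> nat) \<Rightarrow> (nat \<Rightarrow> rpoly set) \<Rightarrow> rpoly \<Rightarrow> enat" where
  "sep_rank_action n \<Omega> G \<rho> \<sigma> m C p =
     Inf {enat (card I) | I. \<exists>P. separable_decomposition n \<Omega> G \<rho> \<sigma> m C p I P}"

definition sos_rank_action ::
  "nat \<Rightarrow> (nat set \<Rightarrow> nat) \<Rightarrow> ('g, 'b) monoid_scheme \<Rightarrow> ('g \<Rightarrow> nat \<Rightarrow> nat) \<Rightarrow>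
   ('g \<Rightarrow> facet_copy \<Rightarrow> facet_copy) \<Rightarrow> (nat \<Rightarrow> nat) \<Rightarrow> rpoly \<Rightarrow> enat" where
  "sos_rank_action n \<Omega> G \<rho> \<sigma> m p =
     Inf {enat (card I) | I. \<exists>S q Q. sos_decomposition n \<Omega> G \<rho> \<sigma> m p S q I Q}"

definition sep_rank ::
  "nat \<Rightarrow> (nat set \<Rightarrow> nat) \<Rightarrow> (nat \<Rightarrow> nat) \<Rightarrow> (nat \<Rightarrow> rpoly set) \<Rightarrow> rpoly \<Rightarrow> enat" where
  "sep_rank n \<Omega> m C p =
     sep_rank_action n \<Omega> (singleton_group ()) (\<lambda>_. \<lambda>i\<in>{0..n}. i) (\<lambda>_. \<lambda>f\<in>facet_copies n \<Omega>. f) m C p"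

lemma complex_action_trivial:
  assumes "weighted_simplicial_complex n \<Omega>"
  shows "complex_action n \<Omega> (singleton_group ()) (\<lambda>_. \<lambda>i\<in>{0..n}. i)
           (\<lambda>_. \<lambda>f\<in>facet_copies n \<Omega>. f)"
proof -
  have triv: "group_action (singleton_group ()) E (\<lambda>_. \<lambda>x\<in>E. x)" for E :: "'a set"
  proof -
    have "group_hom (singleton_group ()) (BijGroup E) (\<lambda>_. \<lambda>x\<in>E. x)"
      by (intro group_hom.intro group_hom_axioms.intro group_BijGroup homI)
         (auto simp: BijGroup_def Bij_def bij_betw_def inj_on_def compose_def)
    then show ?thesis
      by (rule group_action.intro)
  qed
  have sub: "F \<subseteq> {0..n}" if "(F, k) \<in> facet_copies n \<Omega>" for F k
    using that by (auto simp: facet_copies_def facets_def simplices_def)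
  show ?thesis
  proof (intro complex_action.intro complex_action_axioms.intro assms triv)
    fix g :: unit and S :: "nat set" assume "S \<subseteq> {0..n}"
    then have "(\<lambda>i\<in>{0..n}. i) ` S = S"
      by (simp add: subset_iff image_def restrict_def)
    then show "\<Omega> ((\<lambda>i\<in>{0..n}. i) ` S) = \<Omega> S" by simp
  next
    fix g :: unit and f assume f: "f \<in> facet_copies n \<Omega>"
    then have "fst f \<subseteq> {0..n}"
      using sub[of "fst f" "snd f"] by simp
    then have "(\<lambda>i\<in>{0..n}. i) ` fst f = fst f"
      by (simp add: subset_iff image_def restrict_def)
    then show "fst ((\<lambda>f\<in>facet_copies n \<Omega>. f) f) = (\<lambda>i\<in>{0..n}. i) ` fst f"
      using f by simp
  qed simp_all
qed


section \<open>Factorizability\<close>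

definition multiplicity_K ::
  "nat \<Rightarrow> (nat set \<Rightarrow> nat) \<Rightarrow> ('g, 'b) monoid_scheme \<Rightarrow> ('g \<Rightarrow> nat \<Rightarrow> nat) \<Rightarrow>
   ('g \<Rightarrow> facet_copy \<Rightarrow> facet_copy) \<Rightarrow> nat set \<Rightarrow> (facet_copy \<Rightarrow> nat) \<Rightarrow> nat" where
  "multiplicity_K n \<Omega> G \<rho> \<sigma> I \<alpha> =
     card {\<gamma> \<in> facet_copies n \<Omega> \<rightarrow>\<^sub>E I. \<exists>h. \<forall>i \<in> {0..n}.
       h i \<in> carrier G \<and> \<rho> (h i) i = i \<and>
       restrict (translate G \<sigma> (h i) (facet_copies n \<Omega>) \<gamma>) (facet_copies_at n \<Omega> i) =
         restrict \<alpha> (facet_copies_at n \<Omega> i)}"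

definition factorizable ::
  "nat \<Rightarrow> (nat set \<Rightarrow> nat) \<Rightarrow> ('g, 'b) monoid_scheme \<Rightarrow> ('g \<Rightarrow> nat \<Rightarrow> nat) \<Rightarrow>
   ('g \<Rightarrow> facet_copy \<Rightarrow> facet_copy) \<Rightarrow> bool" where
  "factorizable n \<Omega> G \<rho> \<sigma> \<longleftrightarrow>
     (\<forall>I :: nat set. finite I \<longrightarrow>
       (\<exists>C :: nat \<Rightarrow> (facet_copy \<Rightarrow> nat) \<Rightarrow> real.
         (\<forall>i \<in> {0..n}. \<forall>\<beta> \<in> facet_copies_at n \<Omega> i \<rightarrow>\<^sub>E I. C i \<beta> > 0) \<and>
         (\<forall>i \<in> {0..n}. \<forall>g \<in> carrier G. \<forall>\<beta> \<in> facet_copies_at n \<Omega> i \<rightarrow>\<^sub>E I.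
            C (\<rho> g i) (translate G \<sigma> g (facet_copies_at n \<Omega> (\<rho> g i)) \<beta>) = C i \<beta>) \<and>
         (\<forall>\<alpha> \<in> facet_copies n \<Omega> \<rightarrow>\<^sub>E I.
            (\<Prod>i\<in>{0..n}. C i (restrict \<alpha> (facet_copies_at n \<Omega> i))) =
              inverse (real (multiplicity_K n \<Omega> G \<rho> \<sigma> I \<alpha>)))))"

end

theory Submission
  imports Defs
begin

text \<open>
  Squaring \<open>q\<^sub>k = \<Sum>\<^sub>\<alpha> \<Prod>\<^sub>i q\<^sup>[\<^sup>i\<^sup>]\<close> and summing over \<open>k\<close> gives a double sum over pairs \<open>(\<alpha>, \<gamma>)\<close> of products over
  \<open>i\<close> of local sums over \<open>k\<^sub>i\<close>. Reading a pair of index functions as one function into \<open>I \<times> I\<close> turns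
  an sos decomposition into a decomposition, which is part (ii).

  For (iii), a square occurring in the local polynomial at \<open>(i, \<beta>)\<close> is indexed by the \<open>G\<close>-orbit of
  \<open>(i, \<beta>)\<close> together with a number, and it is only used at the members of that orbit. In the double
  sum only the pairs \<open>(\<alpha>, \<gamma>)\<close> with \<open>\<alpha>\<^sub>|\<^sub>i\<close> and \<open>\<gamma>\<^sub>|\<^sub>i\<close> in the same orbit for all \<open>i\<close> survive. There are
  \<open>K\<^sub>\<alpha>\<close> such \<open>\<gamma>\<close> for each \<open>\<alpha>\<close>, and scaling by the square roots of the numbers \<open>C\<^sup>[\<^sup>i\<^sup>]\<^sub>\<beta>\<close> cancels this factor.

  For (iv), freeness gives a map \<open>z\<close> from the facet copies to \<open>G\<close> with \<open>z (g f) = g z f\<close>. The new index set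
  is \<open>I \<times> G\<close>, and the local polynomial at \<open>i\<close> and \<open>(\<beta>, h)\<close> vanishes unless \<open>h\<close> has the form \<open>g z\<close> on the
  copies at \<open>i\<close>, in which case it is the old one at \<open>g i\<close> and \<open>\<^sup>g\<beta>\<close>. By connectedness \<open>g\<close> does not depend
  on \<open>i\<close>, so the new sum is the sum over \<open>g\<close> of the translates of \<open>p\<close>, that is \<open>|G| p\<close>. Spreading
  the factor \<open>1 / |G|\<close> evenly over the vertices keeps the symmetry, and (iii) applies to the result.
\<close>

section \<open>Substitution in polynomials\<close>

text \<open>The inner product of \<open>poly_subst\<close>, named so that multiplicativity on
  monomials can be proved before that on polynomials.\<close>

definition monomial_eval :: "(nat \<times> nat \<Rightarrow> rpoly) \<Rightarrow> (nat \<times> nat \<Rightarrow>\<^sub>0 nat) \<Rightarrow> rpoly" where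
  "monomial_eval s t = (\<Prod>v \<in> Poly_Mapping.keys t. s v ^ Poly_Mapping.lookup t v)"

text \<open>Extra variables have exponent 0 and contribute factors 1. Monomials with different
  supports can thus be compared over one common set.\<close>

lemma monomial_eval_superset:
  assumes "finite V" "Poly_Mapping.keys t \<subseteq> V"
  shows "monomial_eval s t = (\<Prod>v\<in>V. s v ^ Poly_Mapping.lookup t v)"
  unfolding monomial_eval_def
  by (rule prod.mono_neutral_left) (use assms in \<open>auto simp: in_keys_iff\<close>)

lemma monomial_eval_add: "monomial_eval s (t + u) = monomial_eval s t * monomial_eval s u"
proof -
  let ?V = "Poly_Mapping.keys t \<union> Poly_Mapping.keys u"
  show ?thesis
    using Poly_Mapping.keys_add[of t u]
    by (subst (1 2 3) monomial_eval_superset[of ?V])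
       (auto simp: lookup_add power_add prod.distrib)
qed

lemma monomial_eval_zero [simp]: "monomial_eval s 0 = 1"
  by (simp add: monomial_eval_def)

lemma monomial_eval_single [simp]: "monomial_eval s (Poly_Mapping.single v (Suc 0)) = s v"
  by (simp add: monomial_eval_def)

lemma PConst_add: "PConst (a + b) = PConst a + PConst b"
  by (simp add: PConst_def single_add)

lemma PConst_mult: "PConst (a * b) = PConst a * PConst b"
  by (simp add: PConst_def mult_single)

lemma PConst_0 [simp]: "PConst 0 = 0"
  by (simp add: PConst_def)

lemma PConst_1 [simp]: "PConst 1 = 1"
  by (simp add: PConst_def)

lemma PConst_of_nat: "PConst (of_nat k) = of_nat k"
  by (induction k) (simp_all add: PConst_add)

lemma PConst_prod: "PConst (\<Prod>x\<in>A. f x) = (\<Prod>x\<in>A. PConst (f x))"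
  by (induction A rule: infinite_finite_induct) (simp_all add: PConst_mult)

lemma PConst_power: "PConst (a ^ k) = PConst a ^ k"
  by (induction k) (simp_all add: PConst_mult)

text \<open>Monomials outside the support have coefficient 0, so sums over different supports can be
  brought to a common one.\<close>

lemma poly_subst_superset:
  assumes "finite A" "Poly_Mapping.keys p \<subseteq> A"
  shows "poly_subst s p = (\<Sum>t\<in>A. PConst (Poly_Mapping.lookup p t) * monomial_eval s t)"
  unfolding poly_subst_def monomial_eval_def[symmetric]
  by (rule sum.mono_neutral_left) (use assms in \<open>auto simp: in_keys_iff\<close>)

lemma poly_subst_add: "poly_subst s (p + q) = poly_subst s p + poly_subst s q"
proof -
  let ?A = "Poly_Mapping.keys p \<union> Poly_Mapping.keys q"
  show ?thesis
    using Poly_Mapping.keys_add[of p q]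
    by (subst (1 2 3) poly_subst_superset[of ?A])
       (auto simp: lookup_add PConst_add distrib_right sum.distrib)
qed

lemma poly_subst_0 [simp]: "poly_subst s 0 = 0"
  by (simp add: poly_subst_def)

lemma poly_subst_sum: "poly_subst s (\<Sum>x\<in>A. f x) = (\<Sum>x\<in>A. poly_subst s (f x))"
  by (induction A rule: infinite_finite_induct) (simp_all add: poly_subst_add)

lemma poly_subst_single:
  "poly_subst s (Poly_Mapping.single t c) = PConst c * monomial_eval s t"
  by (subst poly_subst_superset[of "{t}"]) auto

lemma sum_single_lookup:
  "(\<Sum>t\<in>Poly_Mapping.keys p. Poly_Mapping.single t (Poly_Mapping.lookup p t)) = p"
  by (rule poly_mapping_eqI) (auto simp: lookup_sum lookup_single when_def in_keys_iff)

text \<open>Both factors are written as sums of single terms, where multiplicativity reduces to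
  \<open>monomial_eval_add\<close>.\<close>

lemma poly_subst_mult: "poly_subst s (p * q) = poly_subst s p * poly_subst s q"
proof -
  let ?m = "\<lambda>p t. Poly_Mapping.single t (Poly_Mapping.lookup p t) :: rpoly"
  have "poly_subst s (p * q) =
      poly_subst s ((\<Sum>t\<in>Poly_Mapping.keys p. ?m p t) * (\<Sum>u\<in>Poly_Mapping.keys q. ?m q u))"
    by (simp only: sum_single_lookup)
  also have "\<dots> = (\<Sum>t\<in>Poly_Mapping.keys p. \<Sum>u\<in>Poly_Mapping.keys q.
      poly_subst s (?m p t) * poly_subst s (?m q u))"
    by (simp add: sum_product poly_subst_sum mult_single poly_subst_single monomial_eval_add
        PConst_mult mult_ac)
  also have "\<dots> = poly_subst s (\<Sum>t\<in>Poly_Mapping.keys p. ?m p t) *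
      poly_subst s (\<Sum>u\<in>Poly_Mapping.keys q. ?m q u)"
    by (simp only: sum_product poly_subst_sum)
  finally show ?thesis by (simp only: sum_single_lookup)
qed

lemma poly_subst_PConst [simp]: "poly_subst s (PConst c) = PConst c"
  unfolding PConst_def poly_subst_single by (simp add: PConst_def)

lemma poly_subst_1 [simp]: "poly_subst s 1 = 1"
  using poly_subst_PConst[of s 1] by simp

lemma poly_subst_PVar [simp]: "poly_subst s (PVar v) = s v"
  unfolding PVar_def poly_subst_single by simp

lemma poly_subst_prod: "poly_subst s (\<Prod>x\<in>A. f x) = (\<Prod>x\<in>A. poly_subst s (f x))"
  by (induction A rule: infinite_finite_induct) (simp_all add: poly_subst_mult)

lemma poly_subst_power: "poly_subst s (p ^ k) = poly_subst s p ^ k"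
  by (induction k) (simp_all add: poly_subst_mult)

lemma poly_subst_monomial_eval:
  "poly_subst s (monomial_eval s' t) = monomial_eval (\<lambda>v. poly_subst s (s' v)) t"
  by (simp add: monomial_eval_def poly_subst_prod poly_subst_power)

lemma poly_subst_poly_subst:
  "poly_subst s (poly_subst s' p) = poly_subst (\<lambda>v. poly_subst s (s' v)) p"
  by (simp add: poly_subst_superset[of "Poly_Mapping.keys p" p] poly_subst_sum poly_subst_mult
      poly_subst_monomial_eval)

lemma poly_subst_cong:
  assumes "p \<in> polys_in V" "\<And>v. v \<in> V \<Longrightarrow> s v = s' v"
  shows "poly_subst s p = poly_subst s' p"
  unfolding poly_subst_def
proof (intro sum.cong prod.cong refl arg_cong2[where f = "(*)"] arg_cong2[where f = "(^)"] assms(2))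
  fix t v assume "t \<in> Poly_Mapping.keys p" "v \<in> Poly_Mapping.keys t"
  then show "v \<in> V" using assms(1) by (auto simp: polys_in_def)
qed

section \<open>Polynomials in a restricted set of variables\<close>

lemma polys_in_PConst [simp]: "PConst c \<in> polys_in V"
  by (auto simp: polys_in_def PConst_def split: if_splits)

lemma polys_in_0 [simp]: "0 \<in> polys_in V"
  by (simp add: polys_in_def)

lemma polys_in_PVar: "v \<in> V \<Longrightarrow> PVar v \<in> polys_in V"
  by (auto simp: polys_in_def PVar_def)

lemma polys_in_add: "p \<in> polys_in V \<Longrightarrow> q \<in> polys_in V \<Longrightarrow> p + q \<in> polys_in V"
  using Poly_Mapping.keys_add[of p q] unfolding polys_in_def by blast

lemma polys_in_mult: "p \<in> polys_in V \<Longrightarrow> q \<in> polys_in V \<Longrightarrow> p * q \<in> polys_in V"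
proof -
  assume pq: "p \<in> polys_in V" "q \<in> polys_in V"
  have "Poly_Mapping.keys t \<subseteq> V" if "t \<in> Poly_Mapping.keys (p * q)" for t
  proof -
    from that Poly_Mapping.keys_mult[of p q] obtain a b
      where "t = a + b" "a \<in> Poly_Mapping.keys p" "b \<in> Poly_Mapping.keys q" by blast
    then show ?thesis using Poly_Mapping.keys_add[of a b] pq unfolding polys_in_def by blast
  qed
  then show ?thesis by (simp add: polys_in_def)
qed

lemma polys_in_sum: "(\<And>x. x \<in> A \<Longrightarrow> f x \<in> polys_in V) \<Longrightarrow> (\<Sum>x\<in>A. f x) \<in> polys_in V"
  by (induction A rule: infinite_finite_induct) (auto intro: polys_in_add)

lemma polys_in_prod: "(\<And>x. x \<in> A \<Longrightarrow> f x \<in> polys_in V) \<Longrightarrow> (\<Prod>x\<in>A. f x) \<in> polys_in V"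
  using polys_in_PConst[of 1 V]
  by (induction A rule: infinite_finite_induct) (auto intro: polys_in_mult)

lemma polys_in_power: "p \<in> polys_in V \<Longrightarrow> p ^ k \<in> polys_in V"
  using polys_in_PConst[of 1 V] by (induction k) (auto intro: polys_in_mult)

lemma polys_in_mono: "V \<subseteq> W \<Longrightarrow> p \<in> polys_in V \<Longrightarrow> p \<in> polys_in W"
  by (auto simp: polys_in_def)

lemma poly_subst_in:
  assumes "p \<in> polys_in V" "\<And>v. v \<in> V \<Longrightarrow> s v \<in> polys_in W"
  shows "poly_subst s p \<in> polys_in W"
  using assms unfolding poly_subst_def polys_in_def[of V]
  by (auto intro!: polys_in_sum polys_in_mult polys_in_prod polys_in_power)

lemma local_polys_subset_global: "i \<in> {0..n} \<Longrightarrow> f \<in> local_polys m i \<Longrightarrow> f \<in> global_polys n m"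
  unfolding local_polys_def global_polys_def by (rule polys_in_mono) auto

section \<open>Moving a local polynomial to another vertex\<close>

lemmas at_vertex_simps =
  poly_subst_add[of "\<lambda>(_, k). PVar (j, k)" for j, folded at_vertex_def]
  poly_subst_mult[of "\<lambda>(_, k). PVar (j, k)" for j, folded at_vertex_def]
  poly_subst_power[of "\<lambda>(_, k). PVar (j, k)" for j, folded at_vertex_def]
  poly_subst_sum[of "\<lambda>(_, k). PVar (j, k)" for j, folded at_vertex_def]
  poly_subst_PConst[of "\<lambda>(_, k). PVar (j, k)" for j, folded at_vertex_def]
  poly_subst_0[of "\<lambda>(_, k). PVar (j, k)" for j, folded at_vertex_def]

text \<open>The outer substitution overwrites the vertex chosen by the inner one and keeps the
  number of the variable.\<close>

lemma at_vertex_at_vertex [simp]: "at_vertex i (at_vertex j f) = at_vertex i f"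
  unfolding at_vertex_def poly_subst_poly_subst
  by (rule arg_cong[where f = "\<lambda>s. poly_subst s f"]) auto

lemma at_vertex_in_local:
  "f \<in> local_polys m i \<Longrightarrow> m i = m j \<Longrightarrow> at_vertex j f \<in> local_polys m j"
  unfolding local_polys_def at_vertex_def
  by (rule poly_subst_in) (auto intro!: polys_in_PVar)

text \<open>Relates the action of \<open>G\<close> on polynomials in all variables to
  \<open>at_vertex\<close>: a local polynomial only sees where its own vertex is sent.\<close>

lemma poly_subst_local:
  "f \<in> local_polys m i \<Longrightarrow> poly_subst (\<lambda>(i, k). PVar (r i, k)) f = at_vertex (r i) f"
  unfolding local_polys_def at_vertex_def
  by (rule poly_subst_cong) auto

section \<open>Group actions on a complex\<close>

text \<open>Supplies numbers as names for equivalence classes, because the sets \<open>S i\<close>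
  of an sos decomposition consist of naturals. The quotient of a finite set is finite and hence
  injects into the naturals.\<close>

lemma equiv_labelling:
  assumes "equiv X R" "finite X"
  shows "\<exists>L :: 'a \<Rightarrow> nat. \<forall>x\<in>X. \<forall>y\<in>X. L x = L y \<longleftrightarrow> (x, y) \<in> R"
proof -
  have "finite (X // R)"
    using assms by (simp add: finite_quotient equiv_type)
  then obtain e :: "'a set \<Rightarrow> nat" where e: "inj_on e (X // R)"
    using finite_imp_inj_to_nat_seg[of "X // R"] by metis
  show ?thesis
  proof (intro exI[of _ "\<lambda>x. e (R `` {x})"] ballI)
    fix x y assume "x \<in> X" "y \<in> X"
    then show "e (R `` {x}) = e (R `` {y}) \<longleftrightarrow> (x, y) \<in> R"
      using inj_on_eq_iff[OF e quotientI quotientI, of x y] eq_equiv_class_iff[OF assms(1), of x y]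
      by auto
  qed
qed

section \<open>Existence and finiteness of facet copies\<close>

context weighted_simplicial_complex
begin

lemma facet_copies_subset: "f \<in> facet_copies n \<Omega> \<Longrightarrow> fst f \<subseteq> {0..n}"
  by (auto simp: facet_copies_def facets_def simplices_def)

lemma finite_facet_copies [simp]: "finite (facet_copies n \<Omega>)"
proof -
  have "facets n \<Omega> \<subseteq> Pow {0..n}"
    by (auto simp: facets_def simplices_def)
  then have "finite (facets n \<Omega>)" by (rule finite_subset) simp
  then show ?thesis unfolding facet_copies_def by blast
qed

lemma finite_facet_copies_at [simp]: "finite (facet_copies_at n \<Omega> i)"
  by (simp add: facet_copies_at_def)

lemma facet_copies_at_subset: "facet_copies_at n \<Omega> i \<subseteq> facet_copies n \<Omega>"
  by (auto simp: facet_copies_at_def)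

text \<open>An empty facet would be properly contained in the simplex \<open>{0}\<close>, against
  maximality.\<close>

lemma facet_copies_nonempty: "f \<in> facet_copies n \<Omega> \<Longrightarrow> fst f \<noteq> {}"
proof
  assume f: "f \<in> facet_copies n \<Omega>" and "fst f = {}"
  then have "{} \<in> facets n \<Omega>" by (auto simp: facet_copies_def)
  moreover have "{0} \<in> simplices n \<Omega>" using weight_vertex[of 0] by (simp add: simplices_def)
  ultimately show False by (auto simp: facets_def)
qed

lemma facet_copy_in_some: "f \<in> facet_copies n \<Omega> \<Longrightarrow> \<exists>i\<in>{0..n}. f \<in> facet_copies_at n \<Omega> i"
  using facet_copies_nonempty[of f] facet_copies_subset[of f] by (auto simp: facet_copies_at_def)

lemma facet_zero_copy: "F \<in> facets n \<Omega> \<Longrightarrow> (F, 0) \<in> facet_copies n \<Omega>"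
  by (auto simp: facet_copies_def facets_def simplices_def)

lemma facet_copies_at_nonempty:
  assumes "i \<in> {0..n}"
  shows "facet_copies_at n \<Omega> i \<noteq> {}"
proof -
  let ?A = "{S \<in> simplices n \<Omega>. i \<in> S}"
  have "?A \<subseteq> Pow {0..n}" by (auto simp: simplices_def)
  then have "finite ?A" by (rule finite_subset) simp
  moreover have "{i} \<in> ?A" using weight_vertex assms by (auto simp: simplices_def)
  ultimately obtain F where "F \<in> ?A" and max: "\<forall>S\<in>?A. F \<subseteq> S \<longrightarrow> F = S"
    using finite_has_maximal2[of ?A "{i}"] by blast
  \<comment> \<open>Every simplex containing \<open>F\<close> contains \<open>i\<close>, so
    maximality within \<open>?A\<close> is maximality among all simplices.\<close>
  then have "F \<in> facets n \<Omega>" by (auto simp: facets_def)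
  then have "(F, 0) \<in> facet_copies_at n \<Omega> i"
    using facet_zero_copy \<open>F \<in> ?A\<close> by (simp add: facet_copies_at_def)
  then show ?thesis by auto
qed

text \<open>Induction along a chain of neighbours. Two consecutive vertices lie in a common facet,
  whose copy 0 serves as \<open>f\<close>; a property read off from values at copies can be passed
  on through it.\<close>

lemma connected_induct:
  assumes "complex_connected n \<Omega>" "i \<in> {0..n}" "j \<in> {0..n}" "P i"
    and step: "\<And>i j f. i \<in> {0..n} \<Longrightarrow> j \<in> {0..n} \<Longrightarrow> f \<in> facet_copies_at n \<Omega> i \<Longrightarrow>
      f \<in> facet_copies_at n \<Omega> j \<Longrightarrow> P i \<Longrightarrow> P j"
  shows "P j"
proof -
  have "(neighbours n \<Omega>)\<^sup>*\<^sup>* i j"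
    using assms by (auto simp: complex_connected_def)
  then show ?thesis
  proof (induction rule: rtranclp_induct)
    case base show ?case by fact
  next
    case (step j k)
    from step.hyps(2) obtain F where "F \<in> facets n \<Omega>" "j \<in> F" "k \<in> F"
      by (auto simp: neighbours_def)
    moreover from this have "j \<in> {0..n}" "k \<in> {0..n}"
      by (auto simp: facets_def simplices_def)
    ultimately show ?case
      using facet_zero_copy[of F] step.IH
      by (intro assms(5)[of j k "(F, 0)"]) (auto simp: facet_copies_at_def)
  qed
qed

end

section \<open>Translating index functions by group elements\<close>

context complex_action
begin

abbreviation "copies_at \<equiv> facet_copies_at n \<Omega>"
abbreviation "copies \<equiv> facet_copies n \<Omega>"

sublocale group G
  using vertices.group_hom group_hom.axioms(1) by auto

lemma vertex_closed: "g \<in> carrier G \<Longrightarrow> i \<in> {0..n} \<Longrightarrow> \<rho> g i \<in> {0..n}"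
  using vertices.element_image by blast

lemma copy_at_image:
  assumes "g \<in> carrier G" "i \<in> {0..n}" "f \<in> copies_at i"
  shows "\<sigma> g f \<in> copies_at (\<rho> g i)"
  using assms copies.element_image[of g f] copy_equivariant[of g f] by (auto simp: facet_copies_at_def)

lemma vertex_inv: "g \<in> carrier G \<Longrightarrow> i \<in> {0..n} \<Longrightarrow> \<rho> (inv g) (\<rho> g i) = i"
  using vertices.orbit_sym_aux by blast

lemma vertex_one: "i \<in> {0..n} \<Longrightarrow> \<rho> \<one> i = i"
  using vertices.id_eq_one by (metis restrict_apply')

lemma copy_one: "f \<in> copies \<Longrightarrow> \<sigma> \<one> f = f"
  using copies.id_eq_one by (metis restrict_apply')

lemma copy_at_image_inv:
  assumes "g \<in> carrier G" "i \<in> {0..n}" "f \<in> copies_at (\<rho> g i)"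
  shows "\<sigma> (inv g) f \<in> copies_at i"
  using copy_at_image[of "inv g" "\<rho> g i" f] assms vertex_inv vertex_closed by auto

lemma translate_at_closed:
  assumes "g \<in> carrier G" "i \<in> {0..n}" "\<beta> \<in> copies_at i \<rightarrow>\<^sub>E I"
  shows "translate G \<sigma> g (copies_at (\<rho> g i)) \<beta> \<in> copies_at (\<rho> g i) \<rightarrow>\<^sub>E I"
  using assms copy_at_image_inv by (auto simp: translate_def)

lemma translate_closed:
  assumes "g \<in> carrier G" "\<alpha> \<in> copies \<rightarrow>\<^sub>E I"
  shows "translate G \<sigma> g copies \<alpha> \<in> copies \<rightarrow>\<^sub>E I"
proof -
  have "\<sigma> (inv g) f \<in> copies" if "f \<in> copies" for f
    using copies.element_image[of "inv g" f] assms that by auto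
  then show ?thesis using assms by (auto simp: translate_def)
qed

text \<open>The intermediate restriction to the copies at \<open>\<rho> h i\<close> is harmless,
  because \<open>\<sigma> (inv g)\<close> carries the copies at
  \<open>\<rho> (g \<otimes> h) i\<close> into that set.\<close>

lemma translate_at_mult:
  assumes "g \<in> carrier G" "h \<in> carrier G" "i \<in> {0..n}"
  shows "translate G \<sigma> g (copies_at (\<rho> (g \<otimes> h) i)) (translate G \<sigma> h (copies_at (\<rho> h i)) \<beta>) =
    translate G \<sigma> (g \<otimes> h) (copies_at (\<rho> (g \<otimes> h) i)) \<beta>"
proof
  fix f
  have comp: "\<rho> (g \<otimes> h) i = \<rho> g (\<rho> h i)"
    using assms by (simp add: vertices.composition_rule)
  show "translate G \<sigma> g (copies_at (\<rho> (g \<otimes> h) i)) (translate G \<sigma> h (copies_at (\<rho> h i)) \<beta>) f =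
      translate G \<sigma> (g \<otimes> h) (copies_at (\<rho> (g \<otimes> h) i)) \<beta> f"
  proof (cases "f \<in> copies_at (\<rho> (g \<otimes> h) i)")
    case True
    then have "\<sigma> (inv g) f \<in> copies_at (\<rho> h i)"
      using copy_at_image_inv assms vertex_closed by (simp add: comp)
    moreover have "\<sigma> (inv (g \<otimes> h)) f = \<sigma> (inv h) (\<sigma> (inv g) f)"
      using True facet_copies_at_subset assms
      by (subst copies.composition_rule[symmetric]) (auto simp: inv_mult_group)
    ultimately show ?thesis using True by (simp add: translate_def)
  qed (simp add: translate_def)
qed

lemma translate_at_one:
  assumes "i \<in> {0..n}" "\<beta> \<in> copies_at i \<rightarrow>\<^sub>E I"
  shows "translate G \<sigma> \<one> (copies_at i) \<beta> = \<beta>"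
proof
  fix f
  show "translate G \<sigma> \<one> (copies_at i) \<beta> f = \<beta> f"
  proof (cases "f \<in> copies_at i")
    case True
    then have "f \<in> copies" using facet_copies_at_subset by blast
    then show ?thesis using True copy_one by (simp add: translate_def)
  qed (simp add: translate_def PiE_arb[OF assms(2)])
qed

lemma translate_translate_inv:
  assumes "g \<in> carrier G" "\<alpha> \<in> copies \<rightarrow>\<^sub>E I"
  shows "translate G \<sigma> g copies (translate G \<sigma> (inv g) copies \<alpha>) = \<alpha>"
proof
  fix f
  show "translate G \<sigma> g copies (translate G \<sigma> (inv g) copies \<alpha>) f = \<alpha> f"
  proof (cases "f \<in> copies")
    case True
    then show ?thesis
      using assms(1) copies.element_image[of "inv g" f] copies.orbit_sym_aux[of "inv g" f]
      by (simp add: translate_def)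
  qed (simp add: translate_def PiE_arb[OF assms(2)])
qed

lemma bij_betw_translate:
  assumes g: "g \<in> carrier G"
  shows "bij_betw (translate G \<sigma> g copies) (copies \<rightarrow>\<^sub>E I) (copies \<rightarrow>\<^sub>E I)"
proof (rule bij_betw_byWitness[where f' = "translate G \<sigma> (inv g) copies"])
  show "\<forall>\<alpha>\<in>copies \<rightarrow>\<^sub>E I. translate G \<sigma> (inv g) copies (translate G \<sigma> g copies \<alpha>) = \<alpha>"
    using g translate_translate_inv[of "inv g" _ I] by simp
  show "\<forall>\<alpha>\<in>copies \<rightarrow>\<^sub>E I. translate G \<sigma> g copies (translate G \<sigma> (inv g) copies \<alpha>) = \<alpha>"
    using g translate_translate_inv[of g _ I] by simp
  show "translate G \<sigma> g copies ` (copies \<rightarrow>\<^sub>E I) \<subseteq> copies \<rightarrow>\<^sub>E I"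
    by (rule image_subsetI) (rule translate_closed[OF g])
  show "translate G \<sigma> (inv g) copies ` (copies \<rightarrow>\<^sub>E I) \<subseteq> copies \<rightarrow>\<^sub>E I"
    by (rule image_subsetI) (rule translate_closed[OF inv_closed[OF g]])
qed

text \<open>At copies at \<open>\<rho> g i\<close> the translate only evaluates
  \<open>\<alpha>\<close> at copies at \<open>i\<close>. This links sums over global index functions
  to the symmetry of local polynomials.\<close>

lemma restrict_translate:
  assumes "g \<in> carrier G" "i \<in> {0..n}"
  shows "restrict (translate G \<sigma> g copies \<alpha>) (copies_at (\<rho> g i)) =
    translate G \<sigma> g (copies_at (\<rho> g i)) (restrict \<alpha> (copies_at i))"
proof
  fix f
  show "restrict (translate G \<sigma> g copies \<alpha>) (copies_at (\<rho> g i)) f =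
      translate G \<sigma> g (copies_at (\<rho> g i)) (restrict \<alpha> (copies_at i)) f"
    using assms copy_at_image_inv[of g i f] facet_copies_at_subset[of "\<rho> g i"]
    by (auto simp: translate_def)
qed

lemma restrict_copies_at: "\<alpha> \<in> copies \<rightarrow>\<^sub>E I \<Longrightarrow> restrict \<alpha> (copies_at i) \<in> copies_at i \<rightarrow>\<^sub>E I"
  by (rule restrict_PiE_iff[THEN iffD2]) (use facet_copies_at_subset in \<open>blast dest: PiE_mem\<close>)

text \<open>Lying in one orbit, for the action of \<open>G\<close> on pairs of a vertex and a local
  index function. The symmetry of a decomposition says that, up to renaming variables, the local
  polynomials are constant on these orbits.\<close>

definition local_orbit_rel :: "nat set \<Rightarrow> ((nat \<times> (facet_copy \<Rightarrow> nat)) \<times> (nat \<times> (facet_copy \<Rightarrow> nat))) set" where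
  "local_orbit_rel I = {((i, \<beta>), (j, \<gamma>)). i \<in> {0..n} \<and> \<beta> \<in> copies_at i \<rightarrow>\<^sub>E I \<and>
     (\<exists>g\<in>carrier G. j = \<rho> g i \<and> \<gamma> = translate G \<sigma> g (copies_at j) \<beta>)}"

lemma local_orbit_relI:
  assumes "i \<in> {0..n}" "\<beta> \<in> copies_at i \<rightarrow>\<^sub>E I" "g \<in> carrier G"
  shows "((i, \<beta>), (\<rho> g i, translate G \<sigma> g (copies_at (\<rho> g i)) \<beta>)) \<in> local_orbit_rel I"
  using assms unfolding local_orbit_rel_def by blast

lemma local_orbit_relE:
  assumes "((i, \<beta>), y) \<in> local_orbit_rel I"
  obtains g where "i \<in> {0..n}" "\<beta> \<in> copies_at i \<rightarrow>\<^sub>E I" "g \<in> carrier G"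
    "y = (\<rho> g i, translate G \<sigma> g (copies_at (\<rho> g i)) \<beta>)"
  using assms unfolding local_orbit_rel_def by blast

lemma equiv_local_orbit_rel:
  "equiv (SIGMA i:{0..n}. copies_at i \<rightarrow>\<^sub>E I) (local_orbit_rel I)" (is "equiv ?X _")
proof (rule equivI)
  show "local_orbit_rel I \<subseteq> ?X \<times> ?X"
  proof (rule subrelI)
    fix x y assume xy: "(x, y) \<in> local_orbit_rel I"
    obtain i \<beta> where x: "x = (i, \<beta>)" by fastforce
    show "(x, y) \<in> ?X \<times> ?X"
      using xy unfolding x
    proof (rule local_orbit_relE)
      fix g assume g: "i \<in> {0..n}" "\<beta> \<in> copies_at i \<rightarrow>\<^sub>E I" "g \<in> carrier G"
        "y = (\<rho> g i, translate G \<sigma> g (copies_at (\<rho> g i)) \<beta>)"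
      then show "((i, \<beta>), y) \<in> ?X \<times> ?X"
        using vertex_closed[OF g(3,1)] translate_at_closed[OF g(3,1,2)] by simp
    qed
  qed
  show "refl_on ?X (local_orbit_rel I)"
  proof (rule refl_onI)
    fix x assume "x \<in> ?X"
    then obtain i \<beta> where x: "x = (i, \<beta>)" "i \<in> {0..n}" "\<beta> \<in> copies_at i \<rightarrow>\<^sub>E I" by blast
    then show "(x, x) \<in> local_orbit_rel I"
      using local_orbit_relI[of i \<beta> I \<one>] vertex_one[of i] translate_at_one[of i \<beta> I] by simp
  qed
  show "sym (local_orbit_rel I)"
  proof (rule symI)
    fix x y assume xy: "(x, y) \<in> local_orbit_rel I"
    obtain i \<beta> where x: "x = (i, \<beta>)" by fastforce
    from xy x obtain g where g: "i \<in> {0..n}" "\<beta> \<in> copies_at i \<rightarrow>\<^sub>E I" "g \<in> carrier G"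
        "y = (\<rho> g i, translate G \<sigma> g (copies_at (\<rho> g i)) \<beta>)"
      by (auto elim: local_orbit_relE)
    have "translate G \<sigma> (inv g) (copies_at i) (translate G \<sigma> g (copies_at (\<rho> g i)) \<beta>) = \<beta>"
      using translate_at_mult[of "inv g" g i \<beta>] g vertex_one[of i] translate_at_one[of i \<beta> I] by simp
    then show "(y, x) \<in> local_orbit_rel I"
      using local_orbit_relI[OF vertex_closed[OF g(3,1)] translate_at_closed[OF g(3,1,2)] inv_closed[OF g(3)]] g
      by (simp add: x vertex_inv)
  qed
  show "trans (local_orbit_rel I)"
  proof (rule transI)
    fix x y z assume xyz: "(x, y) \<in> local_orbit_rel I" "(y, z) \<in> local_orbit_rel I"
    obtain i \<beta> where x: "x = (i, \<beta>)" by fastforce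
    from xyz(1) x obtain g where g: "i \<in> {0..n}" "\<beta> \<in> copies_at i \<rightarrow>\<^sub>E I" "g \<in> carrier G"
        "y = (\<rho> g i, translate G \<sigma> g (copies_at (\<rho> g i)) \<beta>)"
      by (auto elim: local_orbit_relE)
    from xyz(2) g(4) obtain h where h: "h \<in> carrier G" "z = (\<rho> h (\<rho> g i),
        translate G \<sigma> h (copies_at (\<rho> h (\<rho> g i))) (translate G \<sigma> g (copies_at (\<rho> g i)) \<beta>))"
      by (auto elim: local_orbit_relE)
    have "z = (\<rho> (h \<otimes> g) i, translate G \<sigma> (h \<otimes> g) (copies_at (\<rho> (h \<otimes> g) i)) \<beta>)"
      using h g translate_at_mult[of h g i \<beta>] by (simp add: vertices.composition_rule)
    then show "(x, z) \<in> local_orbit_rel I"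
      unfolding x using g h by (simp only:) (rule local_orbit_relI, simp_all)
  qed
qed

lemma finite_local_index: "finite I \<Longrightarrow> finite (SIGMA i:{0..n}. copies_at i \<rightarrow>\<^sub>E I)"
  by (auto intro!: finite_PiE)

text \<open>For two pairs with the same vertex \<open>i\<close>, a group element relating them must
  fix \<open>i\<close>. As the elements may be chosen at each vertex separately, the choice function
  \<open>h\<close> amounts to one existential per vertex.\<close>

lemma multiplicity_K_eq:
  assumes "\<alpha> \<in> copies \<rightarrow>\<^sub>E I"
  shows "multiplicity_K n \<Omega> G \<rho> \<sigma> I \<alpha> = card {\<gamma> \<in> copies \<rightarrow>\<^sub>E I. \<forall>i\<in>{0..n}.
    ((i, restrict \<gamma> (copies_at i)), (i, restrict \<alpha> (copies_at i))) \<in> local_orbit_rel I}"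
  unfolding multiplicity_K_def
proof (rule arg_cong[where f = card], rule Collect_cong, rule conj_cong[OF refl])
  fix \<gamma> assume \<gamma>: "\<gamma> \<in> copies \<rightarrow>\<^sub>E I"
  have "((i, restrict \<gamma> (copies_at i)), (i, restrict \<alpha> (copies_at i))) \<in> local_orbit_rel I \<longleftrightarrow>
      (\<exists>g. g \<in> carrier G \<and> \<rho> g i = i \<and>
        restrict (translate G \<sigma> g copies \<gamma>) (copies_at i) = restrict \<alpha> (copies_at i))"
    (is "?L i \<longleftrightarrow> ?R i") if i: "i \<in> {0..n}" for i
  proof
    assume "?L i"
    then show "?R i"
    proof (rule local_orbit_relE)
      fix g assume g: "g \<in> carrier G" "(i, restrict \<alpha> (copies_at i)) =
        (\<rho> g i, translate G \<sigma> g (copies_at (\<rho> g i)) (restrict \<gamma> (copies_at i)))"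
      then have "\<rho> g i = i" by simp
      with g show "?R i"
        using restrict_translate[OF g(1) i, of \<gamma>] by (intro exI[of _ g]) simp
    qed
  next
    assume "?R i"
    then obtain g where g: "g \<in> carrier G" "\<rho> g i = i"
        "restrict (translate G \<sigma> g copies \<gamma>) (copies_at i) = restrict \<alpha> (copies_at i)"
      by blast
    then show "?L i"
      using local_orbit_relI[OF i restrict_copies_at[OF \<gamma>] g(1)] restrict_translate[OF g(1) i, of \<gamma>]
      by (simp only:)
  qed
  then show "(\<exists>h. \<forall>i \<in> {0..n}. h i \<in> carrier G \<and> \<rho> (h i) i = i \<and>
       restrict (translate G \<sigma> (h i) copies \<gamma>) (copies_at i) = restrict \<alpha> (copies_at i)) \<longleftrightarrow>
     (\<forall>i\<in>{0..n}. ((i, restrict \<gamma> (copies_at i)), (i, restrict \<alpha> (copies_at i))) \<in> local_orbit_rel I)"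
    by (simp add: bchoice_iff)
qed

end

section \<open>Sums of squares and separable decompositions\<close>

lemma real_sqrt_prod: "sqrt (\<Prod>x\<in>A. f x) = (\<Prod>x\<in>A. sqrt (f x))"
  by (induction A rule: infinite_finite_induct) (simp_all add: real_sqrt_mult)

text \<open>After expanding the square, the sum over the choice functions \<open>ks\<close> is moved
  inside, where distributivity turns a sum of products into a product of sums.\<close>

lemma sum_square_prod_PiE:
  fixes Q :: "'i \<Rightarrow> 'k \<Rightarrow> 'b \<Rightarrow> 'c::comm_semiring_1"
  assumes "finite V" "\<And>i. i \<in> V \<Longrightarrow> finite (S i)"
  shows "(\<Sum>ks\<in>Pi\<^sub>E V S. (\<Sum>\<alpha>\<in>A. \<Prod>i\<in>V. Q i (ks i) (r i \<alpha>))\<^sup>2) =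
    (\<Sum>\<alpha>\<in>A. \<Sum>\<gamma>\<in>A. \<Prod>i\<in>V. \<Sum>k\<in>S i. Q i k (r i \<alpha>) * Q i k (r i \<gamma>))"
proof -
  have "(\<Sum>ks\<in>Pi\<^sub>E V S. (\<Sum>\<alpha>\<in>A. \<Prod>i\<in>V. Q i (ks i) (r i \<alpha>))\<^sup>2) =
      (\<Sum>ks\<in>Pi\<^sub>E V S. \<Sum>\<alpha>\<in>A. \<Sum>\<gamma>\<in>A. \<Prod>i\<in>V. Q i (ks i) (r i \<alpha>) * Q i (ks i) (r i \<gamma>))"
    by (simp add: power2_eq_square sum_product prod.distrib)
  also have "\<dots> = (\<Sum>\<alpha>\<in>A. \<Sum>ks\<in>Pi\<^sub>E V S. \<Sum>\<gamma>\<in>A. \<Prod>i\<in>V. Q i (ks i) (r i \<alpha>) * Q i (ks i) (r i \<gamma>))"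
    by (rule sum.swap)
  also have "\<dots> = (\<Sum>\<alpha>\<in>A. \<Sum>\<gamma>\<in>A. \<Sum>ks\<in>Pi\<^sub>E V S. \<Prod>i\<in>V. Q i (ks i) (r i \<alpha>) * Q i (ks i) (r i \<gamma>))"
    by (intro sum.cong refl sum.swap)
  finally show ?thesis
    using assms by (simp add: prod_sum_PiE)
qed

text \<open>Pairs of values are encoded by \<open>prod_encode\<close>, because index sets are sets
  of naturals.\<close>

lemma bij_betw_pair_PiE:
  "bij_betw (\<lambda>(\<alpha>, \<gamma>). \<lambda>f\<in>A. prod_encode (\<alpha> f, \<gamma> f))
     ((A \<rightarrow>\<^sub>E I) \<times> (A \<rightarrow>\<^sub>E K)) (A \<rightarrow>\<^sub>E prod_encode ` (I \<times> K))"
proof (rule bij_betw_byWitness[where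
      f' = "\<lambda>\<beta>. (\<lambda>f\<in>A. fst (prod_decode (\<beta> f)), \<lambda>f\<in>A. snd (prod_decode (\<beta> f)))"])
  show "\<forall>x\<in>(A \<rightarrow>\<^sub>E I) \<times> (A \<rightarrow>\<^sub>E K). (\<lambda>\<beta>. (\<lambda>f\<in>A. fst (prod_decode (\<beta> f)), \<lambda>f\<in>A. snd (prod_decode (\<beta> f))))
      ((\<lambda>(\<alpha>, \<gamma>). \<lambda>f\<in>A. prod_encode (\<alpha> f, \<gamma> f)) x) = x"
    by (auto simp: PiE_iff fun_eq_iff extensional_def)
  show "\<forall>\<beta>\<in>A \<rightarrow>\<^sub>E prod_encode ` (I \<times> K). (\<lambda>(\<alpha>, \<gamma>). \<lambda>f\<in>A. prod_encode (\<alpha> f, \<gamma> f))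
      (\<lambda>f\<in>A. fst (prod_decode (\<beta> f)), \<lambda>f\<in>A. snd (prod_decode (\<beta> f))) = \<beta>"
    by (auto simp: PiE_iff fun_eq_iff extensional_def)
qed (auto simp: PiE_iff, force+)

section \<open>Decompositions built from pairs and from orbits\<close>

context complex_action
begin

text \<open>Translation changes the arguments and \<open>\<phi>\<close> the values, so they commute.
  It is used with \<open>\<phi>\<close> a component of a decoded pair.\<close>

lemma translate_map:
  assumes "g \<in> carrier G" "i \<in> {0..n}"
  shows "translate G \<sigma> g (copies_at (\<rho> g i)) (\<lambda>f\<in>copies_at i. \<phi> (\<beta> f)) =
    (\<lambda>f\<in>copies_at (\<rho> g i). \<phi> (translate G \<sigma> g (copies_at (\<rho> g i)) \<beta> f))"
  using copy_at_image_inv[OF assms] by (auto simp: translate_def fun_eq_iff)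

text \<open>The local factor collects the sum over \<open>k\<close> for two index functions at
  \<open>i\<close>. It inherits the symmetry because \<open>S\<close> is constant on vertex orbits
  and \<open>at_vertex\<close> respects sums and products.\<close>

lemma decomposition_of_sos:
  assumes "sos_decomposition n \<Omega> G \<rho> \<sigma> m p S q I Q"
  shows "\<exists>P. decomposition n \<Omega> G \<rho> \<sigma> m p (prod_encode ` (I \<times> I)) P"
proof -
  have S: "\<And>i. i \<in> {0..n} \<Longrightarrow> finite (S i)"
      "\<And>i g. i \<in> {0..n} \<Longrightarrow> g \<in> carrier G \<Longrightarrow> S (\<rho> g i) = S i"
    and p: "p = (\<Sum>ks \<in> Pi\<^sub>E {0..n} S. (q ks)\<^sup>2)"
    and fam: "family_decomposition n \<Omega> G \<rho> \<sigma> m S q I Q"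
    using assms by (auto simp: sos_decomposition_def)
  from fam have I: "finite I"
    and Qloc: "\<And>i k \<beta>. i \<in> {0..n} \<Longrightarrow> k \<in> S i \<Longrightarrow> \<beta> \<in> copies_at i \<rightarrow>\<^sub>E I \<Longrightarrow> Q i k \<beta> \<in> local_polys m i"
    and q: "\<And>ks. ks \<in> Pi\<^sub>E {0..n} S \<Longrightarrow> q ks = (\<Sum>\<alpha> \<in> copies \<rightarrow>\<^sub>E I.
        \<Prod>i\<in>{0..n}. Q i (ks i) (restrict \<alpha> (copies_at i)))"
    and Qinv: "\<And>i k g \<beta>. i \<in> {0..n} \<Longrightarrow> k \<in> S i \<Longrightarrow> g \<in> carrier G \<Longrightarrow> \<beta> \<in> copies_at i \<rightarrow>\<^sub>E I \<Longrightarrow>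
        at_vertex i (Q (\<rho> g i) k (translate G \<sigma> g (copies_at (\<rho> g i)) \<beta>)) = Q i k \<beta>"
    unfolding family_decomposition_def by auto
  let ?J = "prod_encode ` (I \<times> I)"
  let ?a = "\<lambda>i \<beta>. \<lambda>f\<in>copies_at i. fst (prod_decode (\<beta> f))"
  let ?b = "\<lambda>i \<beta>. \<lambda>f\<in>copies_at i. snd (prod_decode (\<beta> f))"
  have ab: "?a i \<beta> \<in> copies_at i \<rightarrow>\<^sub>E I" "?b i \<beta> \<in> copies_at i \<rightarrow>\<^sub>E I"
    if "\<beta> \<in> copies_at i \<rightarrow>\<^sub>E ?J" for i \<beta>
  proof -
    have "fst (prod_decode (\<beta> f)) \<in> I \<and> snd (prod_decode (\<beta> f)) \<in> I" if "f \<in> copies_at i" for f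
      using PiE_mem[OF \<open>\<beta> \<in> _\<close> that] by auto
    then show "?a i \<beta> \<in> copies_at i \<rightarrow>\<^sub>E I" "?b i \<beta> \<in> copies_at i \<rightarrow>\<^sub>E I"
      by (auto simp del: PiE_iff)
  qed
  \<comment> \<open>\<open>?a\<close> and \<open>?b\<close> recover the two local index functions
    that \<open>\<beta>\<close> encodes.\<close>
  define P where "P i \<beta> = (\<Sum>k\<in>S i. Q i k (?a i \<beta>) * Q i k (?b i \<beta>))" for i \<beta>
  have "decomposition n \<Omega> G \<rho> \<sigma> m p ?J P"
    unfolding decomposition_def
  proof (intro conjI ballI)
    show "finite ?J" using I by simp
  next
    fix i \<beta> assume "i \<in> {0..n}" "\<beta> \<in> copies_at i \<rightarrow>\<^sub>E ?J"
    then show "P i \<beta> \<in> local_polys m i"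
      unfolding P_def using Qloc ab[of \<beta> i] unfolding local_polys_def
      by (intro polys_in_sum polys_in_mult) auto
  next
    have restr: "?a i (restrict (\<lambda>f\<in>copies. prod_encode (\<alpha> f, \<gamma> f)) (copies_at i)) = restrict \<alpha> (copies_at i)"
        "?b i (restrict (\<lambda>f\<in>copies. prod_encode (\<alpha> f, \<gamma> f)) (copies_at i)) = restrict \<gamma> (copies_at i)"
      for \<alpha> \<gamma> :: "facet_copy \<Rightarrow> nat" and i
      using facet_copies_at_subset[of i] by (auto simp: fun_eq_iff)
    have "p = (\<Sum>ks \<in> Pi\<^sub>E {0..n} S. (\<Sum>\<alpha> \<in> copies \<rightarrow>\<^sub>E I.
        \<Prod>i\<in>{0..n}. Q i (ks i) (restrict \<alpha> (copies_at i)))\<^sup>2)"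
      unfolding p by (intro sum.cong refl) (simp only: q)
    also have "\<dots> = (\<Sum>\<alpha>\<in>copies \<rightarrow>\<^sub>E I. \<Sum>\<gamma>\<in>copies \<rightarrow>\<^sub>E I. \<Prod>i\<in>{0..n}. \<Sum>k\<in>S i.
        Q i k (restrict \<alpha> (copies_at i)) * Q i k (restrict \<gamma> (copies_at i)))"
      using S(1) by (intro sum_square_prod_PiE[where r = "\<lambda>i \<alpha>. restrict \<alpha> (copies_at i)"]) auto
    also have "\<dots> = (\<Sum>(\<alpha>, \<gamma>)\<in>(copies \<rightarrow>\<^sub>E I) \<times> (copies \<rightarrow>\<^sub>E I).
        \<Prod>i\<in>{0..n}. P i (restrict (\<lambda>f\<in>copies. prod_encode (\<alpha> f, \<gamma> f)) (copies_at i)))"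
      unfolding sum.cartesian_product P_def restr ..
    also have "\<dots> = (\<Sum>\<alpha>\<in>copies \<rightarrow>\<^sub>E ?J. \<Prod>i\<in>{0..n}. P i (restrict \<alpha> (copies_at i)))"
      by (subst sum.reindex_bij_betw[OF bij_betw_pair_PiE, symmetric]) (simp add: split_beta)
    finally show "p = (\<Sum>\<alpha>\<in>copies \<rightarrow>\<^sub>E ?J. \<Prod>i\<in>{0..n}. P i (restrict \<alpha> (copies_at i)))" .
  next
    fix i g \<beta> assume i: "i \<in> {0..n}" and g: "g \<in> carrier G" and \<beta>: "\<beta> \<in> copies_at i \<rightarrow>\<^sub>E ?J"
    show "P i \<beta> = at_vertex i (P (\<rho> g i) (translate G \<sigma> g (copies_at (\<rho> g i)) \<beta>))"
      unfolding P_def S(2)[OF i g] at_vertex_simps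
        translate_map[OF g i, of "\<lambda>x. fst (prod_decode x)" \<beta>, symmetric]
        translate_map[OF g i, of "\<lambda>x. snd (prod_decode x)" \<beta>, symmetric]
      by (intro sum.cong refl) (simp only: Qinv[OF i _ g ab(1)[OF \<beta>]] Qinv[OF i _ g ab(2)[OF \<beta>]])
  qed
  then show ?thesis by blast
qed

text \<open>Sums of squares chosen separately at the members of an orbit need not correspond under
  \<open>G\<close>. So one representation is fixed per orbit, at the representative
  \<open>r l\<close>, and carried to the other members by \<open>at_vertex\<close>.\<close>

lemma sos_orbit_representation:
  assumes m: "\<And>g i. g \<in> carrier G \<Longrightarrow> i \<in> {0..n} \<Longrightarrow> m (\<rho> g i) = m i"
    and "separable_decomposition n \<Omega> G \<rho> \<sigma> m (sos_cone m) p I P"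
    and L: "\<And>i \<beta> j \<gamma>. i \<in> {0..n} \<Longrightarrow> \<beta> \<in> copies_at i \<rightarrow>\<^sub>E I \<Longrightarrow> j \<in> {0..n} \<Longrightarrow> \<gamma> \<in> copies_at j \<rightarrow>\<^sub>E I \<Longrightarrow>
      L (i, \<beta>) = L (j, \<gamma>) \<longleftrightarrow> ((i, \<beta>), (j, \<gamma>)) \<in> local_orbit_rel I"
  shows "\<exists>(N :: nat \<Rightarrow> nat) (h :: nat \<Rightarrow> nat \<Rightarrow> rpoly). \<forall>i\<in>{0..n}. \<forall>\<beta>\<in>copies_at i \<rightarrow>\<^sub>E I.
    (\<forall>j<N (L (i, \<beta>)). at_vertex i (h (L (i, \<beta>)) j) \<in> local_polys m i) \<and>
    P i \<beta> = (\<Sum>j<N (L (i, \<beta>)). (at_vertex i (h (L (i, \<beta>)) j))\<^sup>2)"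
proof -
  let ?X = "SIGMA i:{0..n}. copies_at i \<rightarrow>\<^sub>E I"
  have Psos: "\<And>i \<beta>. i \<in> {0..n} \<Longrightarrow> \<beta> \<in> copies_at i \<rightarrow>\<^sub>E I \<Longrightarrow> P i \<beta> \<in> sos_cone m i"
    and Pinv: "\<And>i g \<beta>. i \<in> {0..n} \<Longrightarrow> g \<in> carrier G \<Longrightarrow> \<beta> \<in> copies_at i \<rightarrow>\<^sub>E I \<Longrightarrow>
        P i \<beta> = at_vertex i (P (\<rho> g i) (translate G \<sigma> g (copies_at (\<rho> g i)) \<beta>))"
    using assms(2) unfolding separable_decomposition_def decomposition_def by blast+
  have "\<forall>l\<in>L ` ?X. \<exists>x. x \<in> ?X \<and> L x = l" by blast
  then obtain r where "\<forall>l\<in>L ` ?X. r l \<in> ?X \<and> L (r l) = l"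
    unfolding bchoice_iff by blast
  then have r: "r l \<in> ?X" "L (r l) = l" if "l \<in> L ` ?X" for l
    using that by blast+
  have "\<forall>l\<in>L ` ?X. \<exists>Nh :: nat \<times> (nat \<Rightarrow> rpoly). (\<forall>j<fst Nh. snd Nh j \<in> local_polys m (fst (r l))) \<and>
      P (fst (r l)) (snd (r l)) = (\<Sum>j<fst Nh. (snd Nh j)\<^sup>2)"
  proof
    fix l assume "l \<in> L ` ?X"
    from r(1)[OF this] have "P (fst (r l)) (snd (r l)) \<in> sos_cone m (fst (r l))"
      by (intro Psos) (auto simp del: PiE_iff)
    then obtain N h where "\<forall>j<N. h j \<in> local_polys m (fst (r l))"
        "P (fst (r l)) (snd (r l)) = (\<Sum>j<N::nat. (h j)\<^sup>2)"
      unfolding sos_cone_def by blast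
    then show "\<exists>Nh :: nat \<times> (nat \<Rightarrow> rpoly). (\<forall>j<fst Nh. snd Nh j \<in> local_polys m (fst (r l))) \<and>
        P (fst (r l)) (snd (r l)) = (\<Sum>j<fst Nh. (snd Nh j)\<^sup>2)"
      by (intro exI[of _ "(N, h)"]) simp
  qed
  then obtain Nh :: "nat \<Rightarrow> nat \<times> (nat \<Rightarrow> rpoly)" where Nh: "\<forall>l\<in>L ` ?X. (\<forall>j<fst (Nh l). snd (Nh l) j \<in> local_polys m (fst (r l))) \<and>
      P (fst (r l)) (snd (r l)) = (\<Sum>j<fst (Nh l). (snd (Nh l) j)\<^sup>2)"
    unfolding bchoice_iff by blast
  show ?thesis
  proof (intro exI[of _ "\<lambda>l. fst (Nh l)"] exI[of _ "\<lambda>l. snd (Nh l)"] ballI conjI allI impI)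
    fix i \<beta> assume i: "i \<in> {0..n}" and \<beta>: "\<beta> \<in> copies_at i \<rightarrow>\<^sub>E I"
    let ?l = "L (i, \<beta>)"
    have l: "?l \<in> L ` ?X" using i \<beta> by blast
    obtain j \<gamma> where rl: "r ?l = (j, \<gamma>)" by fastforce
    then have "j \<in> {0..n}" "\<gamma> \<in> copies_at j \<rightarrow>\<^sub>E I" "L (j, \<gamma>) = ?l"
      using r[OF l] by simp_all
    then have "((i, \<beta>), (j, \<gamma>)) \<in> local_orbit_rel I"
      using L[OF i \<beta>, of j \<gamma>] by simp
    then obtain g where g: "g \<in> carrier G" "j = \<rho> g i" "\<gamma> = translate G \<sigma> g (copies_at j) \<beta>"
      by (rule local_orbit_relE) simp
    have "m j = m i" using m[OF g(1) i] g(2) by simp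
    then show "at_vertex i (snd (Nh ?l) k) \<in> local_polys m i" if "k < fst (Nh ?l)" for k
      using bspec[OF Nh l] that rl by (intro at_vertex_in_local[of _ m j]) simp_all
    have "P i \<beta> = at_vertex i (P j \<gamma>)"
      unfolding g(3) g(2) by (rule Pinv[OF i g(1) \<beta>])
    also have "P j \<gamma> = (\<Sum>k<fst (Nh ?l). (snd (Nh ?l) k)\<^sup>2)"
      using bspec[OF Nh l] rl by simp
    finally show "P i \<beta> = (\<Sum>k<fst (Nh ?l). (at_vertex i (snd (Nh ?l) k))\<^sup>2)"
      by (simp add: at_vertex_simps)
  qed
qed

text \<open>The index set stays \<open>I\<close>, which gives (iii) and turns the separable
  decomposition built for (iv) into an sos decomposition.\<close>

lemma sos_decomposition_of_separable:
  assumes m: "\<And>g i. g \<in> carrier G \<Longrightarrow> i \<in> {0..n} \<Longrightarrow> m (\<rho> g i) = m i"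
    and sep: "separable_decomposition n \<Omega> G \<rho> \<sigma> m (sos_cone m) p I P"
    and fact: "factorizable n \<Omega> G \<rho> \<sigma>"
  shows "\<exists>S q Q. sos_decomposition n \<Omega> G \<rho> \<sigma> m p S q I Q"
proof -
  let ?X = "SIGMA i:{0..n}. copies_at i \<rightarrow>\<^sub>E I"
  let ?A = "copies \<rightarrow>\<^sub>E I"
  have I: "finite I" and
    p: "p = (\<Sum>\<alpha>\<in>?A. \<Prod>i\<in>{0..n}. P i (restrict \<alpha> (copies_at i)))"
    using sep unfolding separable_decomposition_def decomposition_def by blast+
  have finA: "finite ?A" using I by (intro finite_PiE) simp_all
  obtain L :: "nat \<times> (facet_copy \<Rightarrow> nat) \<Rightarrow> nat" where
    L0: "\<forall>x\<in>?X. \<forall>y\<in>?X. L x = L y \<longleftrightarrow> (x, y) \<in> local_orbit_rel I"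
    using equiv_labelling[OF equiv_local_orbit_rel finite_local_index[OF I]] ..
  have L: "L (i, \<beta>) = L (j, \<gamma>) \<longleftrightarrow> ((i, \<beta>), (j, \<gamma>)) \<in> local_orbit_rel I"
    if "i \<in> {0..n}" "\<beta> \<in> copies_at i \<rightarrow>\<^sub>E I" "j \<in> {0..n}" "\<gamma> \<in> copies_at j \<rightarrow>\<^sub>E I" for i \<beta> j \<gamma>
    using that by (intro bspec[OF bspec[OF L0]]) simp_all
  have Linv: "L (\<rho> g i, translate G \<sigma> g (copies_at (\<rho> g i)) \<beta>) = L (i, \<beta>)"
    if "i \<in> {0..n}" "g \<in> carrier G" "\<beta> \<in> copies_at i \<rightarrow>\<^sub>E I" for i g \<beta>
    using L[OF that(1,3) vertex_closed[OF that(2,1)] translate_at_closed[OF that(2,1,3)]]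
      local_orbit_relI[OF that(1,3,2)] by simp
  obtain N :: "nat \<Rightarrow> nat" and h :: "nat \<Rightarrow> nat \<Rightarrow> rpoly" where hloc: "\<And>i \<beta> j. i \<in> {0..n} \<Longrightarrow> \<beta> \<in> copies_at i \<rightarrow>\<^sub>E I \<Longrightarrow> j < N (L (i, \<beta>)) \<Longrightarrow>
        at_vertex i (h (L (i, \<beta>)) j) \<in> local_polys m i"
    and Prep: "\<And>i \<beta>. i \<in> {0..n} \<Longrightarrow> \<beta> \<in> copies_at i \<rightarrow>\<^sub>E I \<Longrightarrow>
        P i \<beta> = (\<Sum>j<N (L (i, \<beta>)). (at_vertex i (h (L (i, \<beta>)) j))\<^sup>2)"
    using sos_orbit_representation[OF m sep L] by blast
  obtain C :: "nat \<Rightarrow> (facet_copy \<Rightarrow> nat) \<Rightarrow> real" where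
    C: "\<forall>i\<in>{0..n}. \<forall>\<beta>\<in>copies_at i \<rightarrow>\<^sub>E I. C i \<beta> > 0"
      "\<forall>i\<in>{0..n}. \<forall>g\<in>carrier G. \<forall>\<beta>\<in>copies_at i \<rightarrow>\<^sub>E I.
        C (\<rho> g i) (translate G \<sigma> g (copies_at (\<rho> g i)) \<beta>) = C i \<beta>"
      "\<forall>\<alpha>\<in>?A. (\<Prod>i\<in>{0..n}. C i (restrict \<alpha> (copies_at i))) =
        inverse (real (multiplicity_K n \<Omega> G \<rho> \<sigma> I \<alpha>))"
    using fact[unfolded factorizable_def, rule_format, OF I] by (elim exE conjE)
  note Cinv = C(2)[rule_format] and CK = C(3)[rule_format]
  \<comment> \<open>A square is named by the label of its orbit and its number there. Taking all
    names at every vertex makes \<open>S\<close> constant.\<close>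
  define \<Lambda> where "\<Lambda> = (SIGMA l:L ` ?X. {..<N l})"
  define S where "S i = prod_encode ` \<Lambda>" for i :: nat
  \<comment> \<open>Outside its own orbit a square is replaced by 0, which later removes the
    unrelated pairs of index functions.\<close>
  define Q where "Q i k \<beta> = (case prod_decode k of (l, j) \<Rightarrow>
      if L (i, \<beta>) = l then PConst (sqrt (C i \<beta>)) * at_vertex i (h l j) else 0)" for i k \<beta>
  define q where "q ks = (\<Sum>\<alpha>\<in>?A. \<Prod>i\<in>{0..n}. Q i (ks i) (restrict \<alpha> (copies_at i)))" for ks
  have fin: "finite (L ` ?X)" by (intro finite_imageI finite_local_index I)
  then have "finite \<Lambda>" by (simp add: \<Lambda>_def)
  have Qloc: "Q i k \<beta> \<in> local_polys m i"
    if "i \<in> {0..n}" "k \<in> S i" "\<beta> \<in> copies_at i \<rightarrow>\<^sub>E I" for i k \<beta>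
  proof -
    from that(2) obtain l j where lj: "k = prod_encode (l, j)" "j < N l"
      by (auto simp: S_def \<Lambda>_def)
    show ?thesis
    proof (cases "L (i, \<beta>) = l")
      case True
      then show ?thesis using hloc[OF that(1,3), of j] lj
        unfolding Q_def local_polys_def by (auto intro!: polys_in_mult)
    qed (simp add: Q_def lj local_polys_def)
  qed
  \<comment> \<open>No square survives on two orbits, so the sum vanishes unless
    \<open>\<beta>\<close> and \<open>\<gamma>\<close> are related; if they are, the squares with
    their common label add up to \<open>P i \<beta>\<close>.\<close>
  have QQ: "(\<Sum>k\<in>S i. Q i k \<beta> * Q i k \<gamma>) =
      (if L (i, \<beta>) = L (i, \<gamma>) then PConst (sqrt (C i \<beta>) * sqrt (C i \<gamma>)) * P i \<beta> else 0)"
    if "i \<in> {0..n}" "\<beta> \<in> copies_at i \<rightarrow>\<^sub>E I" "\<gamma> \<in> copies_at i \<rightarrow>\<^sub>E I" for i \<beta> \<gamma>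
  proof -
    let ?c = "if L (i, \<beta>) = L (i, \<gamma>) then PConst (sqrt (C i \<beta>) * sqrt (C i \<gamma>)) else 0"
    have l: "L (i, \<beta>) \<in> L ` ?X" using that by blast
    have "(\<Sum>k\<in>S i. Q i k \<beta> * Q i k \<gamma>) =
        (\<Sum>(l, j)\<in>\<Lambda>. Q i (prod_encode (l, j)) \<beta> * Q i (prod_encode (l, j)) \<gamma>)"
      unfolding S_def by (subst sum.reindex[OF inj_prod_encode]) (simp add: split_beta)
    also have "\<dots> = (\<Sum>l\<in>L ` ?X. \<Sum>j<N l. Q i (prod_encode (l, j)) \<beta> * Q i (prod_encode (l, j)) \<gamma>)"
      unfolding \<Lambda>_def using fin by (subst sum.Sigma) auto
    also have "\<dots> = (\<Sum>l\<in>L ` ?X. if L (i, \<beta>) = l then \<Sum>j<N l. ?c * (at_vertex i (h l j))\<^sup>2 else 0)"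
      by (intro sum.cong refl) (auto simp: Q_def PConst_mult power2_eq_square mult_ac intro!: sum.cong)
    also have "\<dots> = (\<Sum>j<N (L (i, \<beta>)). ?c * (at_vertex i (h (L (i, \<beta>)) j))\<^sup>2)"
      using fin l by (simp only: sum.delta' if_True)
    also have "\<dots> = ?c * P i \<beta>"
      unfolding Prep[OF that(1,2)] by (simp only: sum_distrib_left)
    finally show ?thesis by simp
  qed
  have K: "multiplicity_K n \<Omega> G \<rho> \<sigma> I \<alpha> = card {\<gamma>\<in>?A. \<forall>i\<in>{0..n}.
      L (i, restrict \<alpha> (copies_at i)) = L (i, restrict \<gamma> (copies_at i))}" if "\<alpha> \<in> ?A" for \<alpha>
    unfolding multiplicity_K_eq[OF that]
    by (intro arg_cong[where f = card] Collect_cong conj_cong ball_cong refl)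
       (metis L restrict_copies_at that)
  have main: "(\<Sum>\<gamma>\<in>?A. \<Prod>i\<in>{0..n}. \<Sum>k\<in>S i. Q i k (restrict \<alpha> (copies_at i)) * Q i k (restrict \<gamma> (copies_at i))) =
      (\<Prod>i\<in>{0..n}. P i (restrict \<alpha> (copies_at i)))" if \<alpha>: "\<alpha> \<in> ?A" for \<alpha>
  proof -
    let ?same = "\<lambda>\<gamma>. \<forall>i\<in>{0..n}. L (i, restrict \<alpha> (copies_at i)) = L (i, restrict \<gamma> (copies_at i))"
    let ?K = "multiplicity_K n \<Omega> G \<rho> \<sigma> I"
    let ?P = "\<Prod>i\<in>{0..n}. P i (restrict \<alpha> (copies_at i))"
    have sqrtC: "(\<Prod>i\<in>{0..n}. sqrt (C i (restrict \<gamma> (copies_at i)))) = sqrt (inverse (real (?K \<gamma>)))"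
      if "\<gamma> \<in> ?A" for \<gamma>
      unfolding CK[OF that, symmetric] by (simp only: real_sqrt_prod)
    have "(\<Prod>i\<in>{0..n}. \<Sum>k\<in>S i. Q i k (restrict \<alpha> (copies_at i)) * Q i k (restrict \<gamma> (copies_at i))) =
        (if ?same \<gamma> then PConst (inverse (real (?K \<alpha>))) * ?P else 0)" if \<gamma>: "\<gamma> \<in> ?A" for \<gamma>
    proof (cases "?same \<gamma>")
      case True
      \<comment> \<open>Index functions with equal labels are related to the same functions, so both
        square roots come from the same multiplicity.\<close>
      have "?K \<gamma> = ?K \<alpha>"
        unfolding K[OF \<alpha>] K[OF \<gamma>] using True by simp
      then have "(\<Prod>i\<in>{0..n}. sqrt (C i (restrict \<alpha> (copies_at i))) * sqrt (C i (restrict \<gamma> (copies_at i)))) =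
          inverse (real (?K \<alpha>))"
        unfolding prod.distrib sqrtC[OF \<alpha>] sqrtC[OF \<gamma>] by simp
      moreover have "(\<Prod>i\<in>{0..n}. \<Sum>k\<in>S i. Q i k (restrict \<alpha> (copies_at i)) * Q i k (restrict \<gamma> (copies_at i))) =
          (\<Prod>i\<in>{0..n}. PConst (sqrt (C i (restrict \<alpha> (copies_at i))) * sqrt (C i (restrict \<gamma> (copies_at i)))) *
            P i (restrict \<alpha> (copies_at i)))"
        by (intro prod.cong refl)
           (simp only: QQ[OF _ restrict_copies_at[OF \<alpha>] restrict_copies_at[OF \<gamma>]] bspec[OF True] if_True simp_thms)
      ultimately show ?thesis
        using True by (simp add: prod.distrib PConst_prod[symmetric])
    next
      case False
      then obtain i where i: "i \<in> {0..n}"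
        "L (i, restrict \<alpha> (copies_at i)) \<noteq> L (i, restrict \<gamma> (copies_at i))" by blast
      then have "(\<Sum>k\<in>S i. Q i k (restrict \<alpha> (copies_at i)) * Q i k (restrict \<gamma> (copies_at i))) = 0"
        by (subst QQ[OF i(1) restrict_copies_at[OF \<alpha>] restrict_copies_at[OF \<gamma>]]) simp
      then have "(\<Prod>i\<in>{0..n}. \<Sum>k\<in>S i. Q i k (restrict \<alpha> (copies_at i)) * Q i k (restrict \<gamma> (copies_at i))) = 0"
        by (intro prod_zero bexI[of _ i] i) simp_all
      then show ?thesis using False by (simp only: if_False)
    qed
    then have "(\<Sum>\<gamma>\<in>?A. \<Prod>i\<in>{0..n}. \<Sum>k\<in>S i. Q i k (restrict \<alpha> (copies_at i)) * Q i k (restrict \<gamma> (copies_at i))) =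
        (\<Sum>\<gamma>\<in>?A. if ?same \<gamma> then PConst (inverse (real (?K \<alpha>))) * ?P else 0)"
      by (intro sum.cong refl)
    \<comment> \<open>The surviving \<open>\<gamma>\<close> are exactly those counted by
      \<open>?K \<alpha>\<close>.\<close>
    also have "\<dots> = of_nat (?K \<alpha>) * (PConst (inverse (real (?K \<alpha>))) * ?P)"
      unfolding sum.inter_filter[OF finA, symmetric] sum_constant K[OF \<alpha>] ..
    also have "\<dots> = PConst (real (?K \<alpha>) * inverse (real (?K \<alpha>))) * ?P"
      by (simp add: PConst_of_nat PConst_mult mult.assoc)
    \<comment> \<open>\<open>\<alpha>\<close> is related to itself and hence counted.\<close>
    also have "?K \<alpha> \<noteq> 0"
      unfolding K[OF \<alpha>] using finA \<alpha> by auto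
    then have "PConst (real (?K \<alpha>) * inverse (real (?K \<alpha>))) * ?P = ?P" by simp
    finally show ?thesis .
  qed
  have "sos_decomposition n \<Omega> G \<rho> \<sigma> m p S q I Q"
    unfolding sos_decomposition_def family_decomposition_def
  proof (intro conjI ballI I)
    show "finite (S i)" for i using \<open>finite \<Lambda>\<close> by (simp add: S_def)
    show "S (\<rho> g i) = S i" for g i by (simp add: S_def)
    show "Q i k \<beta> \<in> local_polys m i" if "i \<in> {0..n}" "k \<in> S i" "\<beta> \<in> copies_at i \<rightarrow>\<^sub>E I" for i k \<beta>
      by (rule Qloc[OF that])
    show "q ks = (\<Sum>\<alpha>\<in>?A. \<Prod>i\<in>{0..n}. Q i (ks i) (restrict \<alpha> (copies_at i)))" for ks
      by (rule q_def)
    show "q ks \<in> global_polys n m" if ks: "ks \<in> Pi\<^sub>E {0..n} S" for ks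
      unfolding q_def global_polys_def
    proof (intro polys_in_sum polys_in_prod)
      fix \<alpha> i assume "\<alpha> \<in> ?A" and i: "i \<in> {0..n}"
      then show "Q i (ks i) (restrict \<alpha> (copies_at i)) \<in> polys_in (SIGMA i:{0..n}. {..<m i})"
        unfolding global_polys_def[symmetric]
        by (intro local_polys_subset_global[OF i] Qloc PiE_mem[OF ks] restrict_copies_at)
    qed
    have "(\<Sum>ks\<in>Pi\<^sub>E {0..n} S. (q ks)\<^sup>2) = (\<Sum>\<alpha>\<in>?A. \<Sum>\<gamma>\<in>?A. \<Prod>i\<in>{0..n}. \<Sum>k\<in>S i.
        Q i k (restrict \<alpha> (copies_at i)) * Q i k (restrict \<gamma> (copies_at i)))"
      unfolding q_def using \<open>finite \<Lambda>\<close>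
      by (intro sum_square_prod_PiE[where r = "\<lambda>i \<alpha>. restrict \<alpha> (copies_at i)"]) (simp_all add: S_def)
    also have "\<dots> = p" unfolding p by (intro sum.cong refl main)
    finally show "p = (\<Sum>ks\<in>Pi\<^sub>E {0..n} S. (q ks)\<^sup>2)" ..
    \<comment> \<open>Both the label and the number \<open>C\<close> are constant on orbits, so
      \<open>g\<close> changes neither the test nor the factor.\<close>
    show "Q i k \<beta> = at_vertex i (Q (\<rho> g i) k (translate G \<sigma> g (copies_at (\<rho> g i)) \<beta>))"
      if "i \<in> {0..n}" "k \<in> S i" "g \<in> carrier G" "\<beta> \<in> copies_at i \<rightarrow>\<^sub>E I" for i k g \<beta>
      by (cases "prod_decode k")
         (simp add: Q_def Linv[OF that(1,3,4)] Cinv[OF that(1,3,4)] at_vertex_simps)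
  qed
  then show ?thesis by blast
qed

end

section \<open>Symmetrising a decomposition\<close>

lemma zero_in_sos_cone: "0 \<in> sos_cone m i"
  unfolding sos_cone_def by (intro CollectI exI[of _ "0::nat"] exI[of _ "\<lambda>_. 0"]) simp

lemma sos_cone_local: "f \<in> sos_cone m i \<Longrightarrow> f \<in> local_polys m i"
  unfolding sos_cone_def local_polys_def by (auto intro!: polys_in_sum polys_in_power)

text \<open>The constant is the square of \<open>PConst (sqrt c)\<close>, and
  \<open>at_vertex\<close> respects sums and squares, so both operations pass inside the
  squares.\<close>

lemma sos_cone_scaled_at_vertex:
  assumes "f \<in> sos_cone m i" "m i = m j" "c \<ge> 0"
  shows "PConst c * at_vertex j f \<in> sos_cone m j"
proof -
  from assms(1) obtain N :: nat and h where h: "\<forall>k<N. h k \<in> local_polys m i" "f = (\<Sum>k<N. (h k)\<^sup>2)"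
    unfolding sos_cone_def by blast
  let ?h = "\<lambda>k. PConst (sqrt c) * at_vertex j (h k)"
  have "PConst c = (PConst (sqrt c))\<^sup>2"
    using assms(3) by (simp add: PConst_power[symmetric])
  then have "PConst c * at_vertex j f = (\<Sum>k<N. (?h k)\<^sup>2)"
    by (simp add: h(2) at_vertex_simps power_mult_distrib sum_distrib_left)
  moreover have "\<forall>k<N. ?h k \<in> local_polys m j"
    using h(1) at_vertex_in_local[of _ m i j] assms(2) unfolding local_polys_def
    by (auto intro!: polys_in_mult)
  ultimately show ?thesis
    unfolding sos_cone_def by (intro CollectI exI[of _ N] exI[of _ ?h] conjI)
qed

section \<open>Free actions and averaging over the group\<close>

context complex_action
begin

text \<open>\<open>inv b \<otimes> a\<close> lies in the stabilizer of \<open>f\<close>, which is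
  trivial.\<close>

lemma free_action_cancel:
  assumes "free_action n \<Omega> G \<sigma>" "f \<in> copies" "a \<in> carrier G" "b \<in> carrier G" "\<sigma> a f = \<sigma> b f"
  shows "a = b"
proof -
  have "\<sigma> (inv b \<otimes> a) f = f"
    using assms copies.orbit_sym_aux[of b f "\<sigma> b f"] by (simp add: copies.composition_rule)
  then have "inv b \<otimes> a \<in> stabilizer G \<sigma> f"
    using assms by (simp add: stabilizer_def)
  then have "inv b \<otimes> a = \<one>"
    using assms(1,2) by (simp add: free_action_def)
  then show ?thesis
    using assms(3,4) by (metis inv_equality inv_inv inv_closed)
qed

text \<open>Here \<open>z f\<close> is the element moving a chosen point of the orbit of
  \<open>f\<close> to \<open>f\<close>. Freeness makes it unique, and uniqueness gives
  equivariance.\<close>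

lemma free_action_equivariant_map:
  assumes "free_action n \<Omega> G \<sigma>"
  shows "\<exists>z. (\<forall>f\<in>copies. z f \<in> carrier G) \<and> (\<forall>g\<in>carrier G. \<forall>f\<in>copies. z (\<sigma> g f) = g \<otimes> z f)"
proof -
  \<comment> \<open>The choice depends on the orbit alone, so all points of an orbit get the same
    representative.\<close>
  define rep where "rep f = (SOME x. x \<in> orbit G \<sigma> f)" for f
  define z where "z f = (SOME g. g \<in> carrier G \<and> \<sigma> g (rep f) = f)" for f
  have rep_orbit: "rep f \<in> orbit G \<sigma> f" if "f \<in> copies" for f
    unfolding rep_def using copies.orbit_refl[OF that] by (rule someI)
  have rep_closed: "rep f \<in> copies" if "f \<in> copies" for f
    using rep_orbit[OF that] copies.element_image[OF _ that refl] unfolding orbit_def by force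
  have z: "z f \<in> carrier G \<and> \<sigma> (z f) (rep f) = f" if "f \<in> copies" for f
  proof -
    have "f \<in> orbit G \<sigma> (rep f)"
      using copies.orbit_sym[OF that rep_closed rep_orbit] that by simp
    then have "\<exists>g. g \<in> carrier G \<and> \<sigma> g (rep f) = f" by (auto simp: orbit_def)
    then show ?thesis unfolding z_def by (rule someI_ex)
  qed
  have rep_inv: "rep (\<sigma> g f) = rep f" if "g \<in> carrier G" "f \<in> copies" for g f
  proof -
    have gf: "\<sigma> g f \<in> copies" using copies.element_image that by blast
    have sub: "orbit G \<sigma> (\<sigma> h x) \<subseteq> orbit G \<sigma> x" if "h \<in> carrier G" "x \<in> copies" for h x
    proof
      fix y assume "y \<in> orbit G \<sigma> (\<sigma> h x)"
      then obtain k where k: "k \<in> carrier G" "y = \<sigma> k (\<sigma> h x)" by (auto simp: orbit_def)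
      then have "y = \<sigma> (k \<otimes> h) x" using that by (simp add: copies.composition_rule)
      moreover have "k \<otimes> h \<in> carrier G" using k that by simp
      ultimately show "y \<in> orbit G \<sigma> x" unfolding orbit_def by blast
    qed
    have "orbit G \<sigma> (\<sigma> g f) = orbit G \<sigma> f"
      using sub[OF that] sub[OF inv_closed[OF that(1)] gf] copies.orbit_sym_aux[OF that refl] by simp
    then show ?thesis by (simp add: rep_def)
  qed
  have "z (\<sigma> g f) = g \<otimes> z f" if g: "g \<in> carrier G" and f: "f \<in> copies" for g f
  proof (rule free_action_cancel[OF assms rep_closed[OF f]])
    have gf: "\<sigma> g f \<in> copies" using copies.element_image that by blast
    show "z (\<sigma> g f) \<in> carrier G" "g \<otimes> z f \<in> carrier G" using z f gf g by auto
    show "\<sigma> (z (\<sigma> g f)) (rep f) = \<sigma> (g \<otimes> z f) (rep f)"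
      using z[OF gf] z[OF f] rep_inv[OF g f] rep_closed[OF f] g by (simp add: copies.composition_rule)
  qed
  then show ?thesis using z by blast
qed

lemma bij_betw_vertices: "g \<in> carrier G \<Longrightarrow> bij_betw (\<rho> g) {0..n} {0..n}"
  using vertices.bij_prop0 by (simp add: Bij_def)

text \<open>Reindexing \<open>\<alpha>\<close> by translation and the vertices by
  \<open>\<rho> g\<close> turns the left side into the substitution \<open>?s\<close> by
  \<open>inv g\<close>, applied to the sum for \<open>p\<close>.\<close>

lemma poly_invariant_decomposition:
  assumes "poly_invariant G \<rho> p" "g \<in> carrier G"
    and loc: "\<And>i \<beta>. i \<in> {0..n} \<Longrightarrow> \<beta> \<in> copies_at i \<rightarrow>\<^sub>E I \<Longrightarrow> P i \<beta> \<in> local_polys m i"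
    and p: "p = (\<Sum>\<alpha>\<in>copies \<rightarrow>\<^sub>E I. \<Prod>i\<in>{0..n}. P i (restrict \<alpha> (copies_at i)))"
  shows "(\<Sum>\<alpha>\<in>copies \<rightarrow>\<^sub>E I. \<Prod>i\<in>{0..n}. at_vertex i
      (P (\<rho> g i) (translate G \<sigma> g (copies_at (\<rho> g i)) (restrict \<alpha> (copies_at i))))) = p"
proof -
  let ?A = "copies \<rightarrow>\<^sub>E I"
  let ?s = "poly_subst (\<lambda>(i, k). PVar (\<rho> (inv g) i, k))"
  let ?F = "\<lambda>\<alpha> j. at_vertex (\<rho> (inv g) j) (P j (restrict \<alpha> (copies_at j)))"
  have "(\<Sum>\<alpha>\<in>?A. \<Prod>i\<in>{0..n}. at_vertex i
      (P (\<rho> g i) (translate G \<sigma> g (copies_at (\<rho> g i)) (restrict \<alpha> (copies_at i))))) =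
      (\<Sum>\<alpha>\<in>?A. \<Prod>i\<in>{0..n}. ?F (translate G \<sigma> g copies \<alpha>) (\<rho> g i))"
    by (intro sum.cong prod.cong refl) (simp only: restrict_translate[OF assms(2)] vertex_inv[OF assms(2)])
  also have "\<dots> = (\<Sum>\<alpha>\<in>?A. \<Prod>i\<in>{0..n}. ?F \<alpha> (\<rho> g i))"
    by (rule sum.reindex_bij_betw[OF bij_betw_translate[OF assms(2)]])
  also have "\<dots> = (\<Sum>\<alpha>\<in>?A. \<Prod>j\<in>{0..n}. ?F \<alpha> j)"
    by (intro sum.cong refl prod.reindex_bij_betw bij_betw_vertices assms)
  also have "\<dots> = (\<Sum>\<alpha>\<in>?A. \<Prod>j\<in>{0..n}. ?s (P j (restrict \<alpha> (copies_at j))))"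
    by (intro sum.cong prod.cong refl poly_subst_local[where m = m, symmetric] loc restrict_copies_at)
  also have "\<dots> = ?s p"
    unfolding p by (simp only: poly_subst_sum poly_subst_prod)
  also have "\<dots> = p"
    using assms(1,2) by (simp add: poly_invariant_def)
  finally show ?thesis .
qed

text \<open>\<open>P\<close> comes without any symmetry. A group element recorded in the index tells
  which translate of \<open>P\<close> to use, and summing over all translates produces the
  symmetry.\<close>

lemma separable_decomposition_of_invariant:
  fixes I :: "nat set"
  assumes m: "\<And>g i. g \<in> carrier G \<Longrightarrow> i \<in> {0..n} \<Longrightarrow> m (\<rho> g i) = m i"
    and conn: "complex_connected n \<Omega>" and free: "free_action n \<Omega> G \<sigma>" and p_inv: "poly_invariant G \<rho> p"
    and I: "finite I"
    and Psos: "\<And>i \<beta>. i \<in> {0..n} \<Longrightarrow> \<beta> \<in> copies_at i \<rightarrow>\<^sub>E I \<Longrightarrow> P i \<beta> \<in> sos_cone m i"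
    and p: "p = (\<Sum>\<alpha>\<in>copies \<rightarrow>\<^sub>E I. \<Prod>i\<in>{0..n}. P i (restrict \<alpha> (copies_at i)))"
  shows "\<exists>J P'. card J = order G * card I \<and> separable_decomposition n \<Omega> G \<rho> \<sigma> m (sos_cone m) p J P'"
proof -
  let ?A = "copies \<rightarrow>\<^sub>E I"
  obtain e :: "'g \<Rightarrow> nat" where e: "inj_on e (carrier G)"
    using finite_imp_inj_to_nat_seg[OF finite_group] by metis
  obtain z where z: "\<And>f. f \<in> copies \<Longrightarrow> z f \<in> carrier G"
      "\<And>g f. g \<in> carrier G \<Longrightarrow> f \<in> copies \<Longrightarrow> z (\<sigma> g f) = g \<otimes> z f"
    using free_action_equivariant_map[OF free] by blast
  define J where "J = prod_encode ` (I \<times> e ` carrier G)"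
  have card_J: "card J = order G * card I"
    unfolding J_def order_def
    by (simp add: card_image inj_prod_encode e card_cartesian_product)
  have fin_J: "finite J" using I finite_group by (simp add: J_def)
  \<comment> \<open>There are \<open>n + 1\<close> vertices, so each takes the root of order
    \<open>Suc n\<close> of the averaging factor.\<close>
  define c where "c = root (Suc n) (1 / real (order G))"
  have order_pos: "order G > 0" using finite_group by (simp add: order_gt_0_iff_finite)
  have c: "c \<ge> 0" "c ^ Suc n = 1 / real (order G)"
    unfolding c_def using order_pos by (simp_all del: power_Suc)
  define a where "a i \<beta> = (\<lambda>f\<in>copies_at i. fst (prod_decode (\<beta> f)))" for i and \<beta> :: "facet_copy \<Rightarrow> nat"
  \<comment> \<open>The group components of \<open>\<beta>\<close> are those of \<open>z\<close>
    multiplied by \<open>g\<close>. One copy at \<open>i\<close> already determines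
    \<open>g\<close>, by injectivity of \<open>e\<close> and cancellation in
    \<open>G\<close>.\<close>
  define sel where "sel i \<beta> g \<longleftrightarrow> g \<in> carrier G \<and>
      (\<forall>f\<in>copies_at i. snd (prod_decode (\<beta> f)) = e (g \<otimes> z f))" for i and \<beta> :: "facet_copy \<Rightarrow> nat" and g
  define T where "T i \<beta> g = PConst c *
      at_vertex i (P (\<rho> g i) (translate G \<sigma> g (copies_at (\<rho> g i)) (a i \<beta>)))" for i \<beta> g
  \<comment> \<open>Index functions that select no group element get the value 0; uniqueness for the
    \<open>THE\<close> is established in \<open>P'_sel\<close>.\<close>
  define P' where "P' i \<beta> = (if \<exists>g. sel i \<beta> g then T i \<beta> (THE g. sel i \<beta> g) else 0)" for i \<beta>
  have e_cancel: "g = h" if "g \<in> carrier G" "h \<in> carrier G" "f \<in> copies" "e (g \<otimes> z f) = e (h \<otimes> z f)" for g h f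
    using that z(1)[OF that(3)] inj_onD[OF e that(4)] by simp
  \<comment> \<open>Vertices sharing a copy read off the same group element from it. Connectedness
    will spread this to all vertices.\<close>
  have sel_unique: "g = h" if "f \<in> copies_at i" "f \<in> copies_at j" "sel i (restrict \<beta> (copies_at i)) g"
      "sel j (restrict \<beta> (copies_at j)) h" for i j f \<beta> g h
  proof -
    have "snd (prod_decode (\<beta> f)) = e (g \<otimes> z f)" "g \<in> carrier G"
      using that(1,3) by (simp_all add: sel_def)
    moreover have "snd (prod_decode (\<beta> f)) = e (h \<otimes> z f)" "h \<in> carrier G"
      using that(2,4) by (simp_all add: sel_def)
    ultimately have "e (g \<otimes> z f) = e (h \<otimes> z f)" "g \<in> carrier G" "h \<in> carrier G" by simp_all
    then show ?thesis using e_cancel[of g h f] facet_copies_at_subset that(1) by blast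
  qed
  have P'_sel: "P' i \<beta> = T i \<beta> g" if i: "i \<in> {0..n}" and s: "sel i \<beta> g" for i \<beta> g
  proof -
    \<comment> \<open>A copy at \<open>i\<close> must exist, since otherwise every group element
      would be selected vacuously.\<close>
    obtain f where f: "f \<in> copies_at i" using facet_copies_at_nonempty[OF i] by blast
    have "h = g" if "sel i \<beta> h" for h
    proof -
      have "snd (prod_decode (\<beta> f)) = e (g \<otimes> z f)" "g \<in> carrier G"
        using s f by (simp_all add: sel_def)
      moreover have "snd (prod_decode (\<beta> f)) = e (h \<otimes> z f)" "h \<in> carrier G"
        using that f by (simp_all add: sel_def)
      ultimately have "e (h \<otimes> z f) = e (g \<otimes> z f)" "g \<in> carrier G" "h \<in> carrier G" by simp_all
      then show ?thesis using e_cancel[of h g f] facet_copies_at_subset f by blast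
    qed
    then have "(THE g. sel i \<beta> g) = g" using s by blast
    then show ?thesis using s by (auto simp: P'_def)
  qed
  have P'_0: "P' i \<beta> = 0" if "\<And>g. \<not> sel i \<beta> g" for i \<beta>
    using that by (simp add: P'_def)
  have a_closed: "a i \<beta> \<in> copies_at i \<rightarrow>\<^sub>E I" if "\<beta> \<in> copies_at i \<rightarrow>\<^sub>E J" for i \<beta>
  proof -
    have "fst (prod_decode (\<beta> f)) \<in> I" if "f \<in> copies_at i" for f
      using PiE_mem[OF \<open>\<beta> \<in> _\<close> that] by (auto simp: J_def)
    then show ?thesis by (auto simp: a_def simp del: PiE_iff)
  qed
  have P'_sos: "P' i \<beta> \<in> sos_cone m i" if i: "i \<in> {0..n}" and \<beta>: "\<beta> \<in> copies_at i \<rightarrow>\<^sub>E J" for i \<beta>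
  proof (cases "\<exists>g. sel i \<beta> g")
    case True
    then obtain g where s: "sel i \<beta> g" by blast
    then have g: "g \<in> carrier G" by (simp add: sel_def)
    show ?thesis
      unfolding P'_sel[OF i s] T_def
      by (intro sos_cone_scaled_at_vertex[OF Psos] vertex_closed translate_at_closed a_closed g i \<beta> m c)
  qed (simp add: P'_def zero_in_sos_cone)
  have P'_inv: "P' i \<beta> = at_vertex i (P' (\<rho> b i) (translate G \<sigma> b (copies_at (\<rho> b i)) \<beta>))"
    if i: "i \<in> {0..n}" and b: "b \<in> carrier G" for i b \<beta>
  proof -
    let ?\<gamma> = "translate G \<sigma> b (copies_at (\<rho> b i)) \<beta>"
    have bi: "\<rho> b i \<in> {0..n}" by (rule vertex_closed[OF b i])
    \<comment> \<open>Equivariance gives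
      \<open>z (\<sigma> (inv b) f) = inv b \<otimes> z f\<close>, so translation by
      \<open>b\<close> multiplies the selected element by \<open>inv b\<close> on the right.\<close>
    have fwd: "sel (\<rho> b i) ?\<gamma> (g \<otimes> inv b)" if "sel i \<beta> g" for g
      unfolding sel_def
    proof (intro conjI ballI)
      have g: "g \<in> carrier G" using that by (simp add: sel_def)
      then show "g \<otimes> inv b \<in> carrier G" using b by simp
      fix f assume f: "f \<in> copies_at (\<rho> b i)"
      have f': "f \<in> copies" using f facet_copies_at_subset by blast
      have "\<sigma> (inv b) f \<in> copies_at i" by (rule copy_at_image_inv[OF b i f])
      then have "snd (prod_decode (\<beta> (\<sigma> (inv b) f))) = e (g \<otimes> z (\<sigma> (inv b) f))"
        using that by (simp add: sel_def)
      then show "snd (prod_decode (?\<gamma> f)) = e (g \<otimes> inv b \<otimes> z f)"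
        using f b g z(1)[OF f'] z(2)[OF inv_closed[OF b] f'] by (simp add: translate_def m_assoc)
    qed
    \<comment> \<open>Conversely, a selection at the translate comes from one at
      \<open>\<beta>\<close>, so both sides of the symmetry vanish together.\<close>
    have bwd: "\<exists>g. sel i \<beta> g" if "sel (\<rho> b i) ?\<gamma> h" for h
    proof (intro exI[of _ "h \<otimes> b"])
      have h: "h \<in> carrier G" using that by (simp add: sel_def)
      show "sel i \<beta> (h \<otimes> b)" unfolding sel_def
      proof (intro conjI ballI)
        show "h \<otimes> b \<in> carrier G" using h b by simp
        fix f assume f: "f \<in> copies_at i"
        have f': "f \<in> copies" using f facet_copies_at_subset by blast
        have bf: "\<sigma> b f \<in> copies_at (\<rho> b i)" by (rule copy_at_image[OF b i f])
        then have "snd (prod_decode (?\<gamma> (\<sigma> b f))) = e (h \<otimes> z (\<sigma> b f))"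
          using that by (simp add: sel_def)
        moreover have "?\<gamma> (\<sigma> b f) = \<beta> f"
          using bf copies.orbit_sym_aux[OF b f'] by (simp add: translate_def)
        ultimately show "snd (prod_decode (\<beta> f)) = e (h \<otimes> b \<otimes> z f)"
          using h b z(1)[OF f'] z(2)[OF b f'] by (simp add: m_assoc)
      qed
    qed
    show ?thesis
    proof (cases "\<exists>g. sel i \<beta> g")
      case True
      then obtain g where s: "sel i \<beta> g" by blast
      then have g: "g \<in> carrier G" by (simp add: sel_def)
      have gb: "g \<otimes> inv b \<in> carrier G" "g \<otimes> inv b \<otimes> b = g"
        using g b by (simp_all add: m_assoc)
      \<comment> \<open>The move by \<open>b\<close> and the changed selection cancel, so both sides
        use the same value of \<open>P\<close> at \<open>\<rho> g i\<close>.\<close>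
      have \<rho>gb: "\<rho> (g \<otimes> inv b) (\<rho> b i) = \<rho> g i"
        using vertices.composition_rule[OF i gb(1) b] gb(2) by simp
      have "a (\<rho> b i) ?\<gamma> = translate G \<sigma> b (copies_at (\<rho> b i)) (a i \<beta>)"
        unfolding a_def by (rule translate_map[OF b i, symmetric])
      then have "translate G \<sigma> (g \<otimes> inv b) (copies_at (\<rho> g i)) (a (\<rho> b i) ?\<gamma>) =
          translate G \<sigma> g (copies_at (\<rho> g i)) (a i \<beta>)"
        using translate_at_mult[OF gb(1) b i, of "a i \<beta>"] gb(2) by simp
      then show ?thesis
        unfolding P'_sel[OF i s] P'_sel[OF bi fwd[OF s]] T_def \<rho>gb
        by (simp add: at_vertex_simps)
    next
      case False
      then have "P' i \<beta> = 0" "P' (\<rho> b i) ?\<gamma> = 0"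
        using bwd by (blast intro: P'_0)+
      then show ?thesis by (simp add: at_vertex_simps)
    qed
  qed
  \<comment> \<open>Parametrises the index functions that select the same \<open>g\<close> at all
    vertices.\<close>
  define \<Phi> where "\<Phi> = (\<lambda>(g, \<alpha>). \<lambda>f\<in>copies. prod_encode (\<alpha> f, e (g \<otimes> z f)))"
  have sel_\<Phi>: "sel i (restrict (\<Phi> (g, \<alpha>)) (copies_at i)) g" if "g \<in> carrier G" for g \<alpha> i
    using that facet_copies_at_subset[of i] by (auto simp: sel_def \<Phi>_def)
  have a_\<Phi>: "a i (restrict (\<Phi> (g, \<alpha>)) (copies_at i)) = restrict \<alpha> (copies_at i)" for i g \<alpha>
    using facet_copies_at_subset[of i] by (auto simp: a_def \<Phi>_def fun_eq_iff)
  have inj_\<Phi>: "inj_on \<Phi> (carrier G \<times> ?A)"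
  proof (rule inj_onI, clarify)
    fix g \<alpha> h \<gamma> assume gh: "g \<in> carrier G" "h \<in> carrier G" and \<alpha>: "\<alpha> \<in> ?A" and \<gamma>: "\<gamma> \<in> ?A"
      and eq: "\<Phi> (g, \<alpha>) = \<Phi> (h, \<gamma>)"
    have *: "\<alpha> f = \<gamma> f \<and> e (g \<otimes> z f) = e (h \<otimes> z f)" if "f \<in> copies" for f
      using fun_cong[OF eq, of f] that by (simp add: \<Phi>_def)
    obtain f where "f \<in> copies"
      using facet_copies_at_nonempty[of 0] facet_copies_at_subset[of 0] by auto
    then have "g = h" using e_cancel[OF gh] * by blast
    moreover have "\<alpha> = \<gamma>" by (rule PiE_ext[OF \<alpha> \<gamma>]) (use * in blast)
    ultimately show "g = h \<and> \<alpha> = \<gamma>" by blast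
  qed
  have \<Phi>_image: "\<Phi> ` (carrier G \<times> ?A) \<subseteq> copies \<rightarrow>\<^sub>E J"
  proof (rule image_subsetI, clarify)
    fix g \<alpha> assume g: "g \<in> carrier G" and \<alpha>: "\<alpha> \<in> ?A"
    have "prod_encode (\<alpha> f, e (g \<otimes> z f)) \<in> J" if "f \<in> copies" for f
      using PiE_mem[OF \<alpha> that] g z(1)[OF that] by (auto simp: J_def)
    then show "\<Phi> (g, \<alpha>) \<in> copies \<rightarrow>\<^sub>E J" by (auto simp: \<Phi>_def simp del: PiE_iff)
  qed
  have vanish: "(\<Prod>i\<in>{0..n}. P' i (restrict \<delta> (copies_at i))) = 0"
    if \<delta>: "\<delta> \<in> copies \<rightarrow>\<^sub>E J" "\<delta> \<notin> \<Phi> ` (carrier G \<times> ?A)" for \<delta>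
  proof (rule ccontr)
    assume nz: "(\<Prod>i\<in>{0..n}. P' i (restrict \<delta> (copies_at i))) \<noteq> 0"
    have ex: "\<exists>g. sel i (restrict \<delta> (copies_at i)) g" if i: "i \<in> {0..n}" for i
      using nz P'_0[of i "restrict \<delta> (copies_at i)"] i by (metis finite_atLeastAtMost prod_zero)
    then obtain g where g0: "sel 0 (restrict \<delta> (copies_at 0)) g" by fastforce
    have g: "g \<in> carrier G" using g0 by (simp add: sel_def)
    \<comment> \<open>Every vertex selects some element by \<open>ex\<close>; neighbours select the
      same one because they share a copy.\<close>
    have all: "sel i (restrict \<delta> (copies_at i)) g" if i: "i \<in> {0..n}" for i
    proof (rule connected_induct[OF conn _ i, of 0 "\<lambda>i. sel i (restrict \<delta> (copies_at i)) g"])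
      fix i j f assume ij: "i \<in> {0..n}" "j \<in> {0..n}" "f \<in> copies_at i" "f \<in> copies_at j"
        and s: "sel i (restrict \<delta> (copies_at i)) g"
      obtain h where h: "sel j (restrict \<delta> (copies_at j)) h" using ex[OF ij(2)] by blast
      then have "g = h" using sel_unique[OF ij(3,4) s] by blast
      then show "sel j (restrict \<delta> (copies_at j)) g" using h by simp
    qed (use g0 in simp_all)
    \<comment> \<open>Facets are nonempty, so every copy lies at some vertex and its group component
      is known.\<close>
    have \<delta>_snd: "snd (prod_decode (\<delta> f)) = e (g \<otimes> z f)" if f: "f \<in> copies" for f
    proof -
      obtain i where "i \<in> {0..n}" "f \<in> copies_at i" using facet_copy_in_some[OF f] by blast
      then show ?thesis using all[of i] by (simp add: sel_def)
    qed
    define \<alpha> where "\<alpha> = (\<lambda>f\<in>copies. fst (prod_decode (\<delta> f)))"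
    have "fst (prod_decode (\<delta> f)) \<in> I" if "f \<in> copies" for f
      using PiE_mem[OF \<delta>(1) that] by (auto simp: J_def)
    then have \<alpha>: "\<alpha> \<in> ?A" by (auto simp: \<alpha>_def simp del: PiE_iff)
    have "\<delta> = \<Phi> (g, \<alpha>)"
    proof
      fix f show "\<delta> f = \<Phi> (g, \<alpha>) f"
      proof (cases "f \<in> copies")
        case True
        then show ?thesis by (simp add: \<Phi>_def \<alpha>_def \<delta>_snd[symmetric])
      qed (simp add: \<Phi>_def PiE_arb[OF \<delta>(1)])
    qed
    then show False using \<delta>(2) g \<alpha> by blast
  qed
  \<comment> \<open>For fixed \<open>g\<close> the sum is that of the translates by
    \<open>g\<close>, which is \<open>p\<close> by invariance, times the product of the factors
    \<open>c\<close>.\<close>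
  have value_\<Phi>: "(\<Sum>\<alpha>\<in>?A. \<Prod>i\<in>{0..n}. P' i (restrict (\<Phi> (g, \<alpha>)) (copies_at i))) =
      PConst (1 / real (order G)) * p" if g: "g \<in> carrier G" for g
  proof -
    have "(\<Sum>\<alpha>\<in>?A. \<Prod>i\<in>{0..n}. P' i (restrict (\<Phi> (g, \<alpha>)) (copies_at i))) =
        (\<Sum>\<alpha>\<in>?A. \<Prod>i\<in>{0..n}. PConst c * at_vertex i
          (P (\<rho> g i) (translate G \<sigma> g (copies_at (\<rho> g i)) (restrict \<alpha> (copies_at i)))))"
      by (intro sum.cong prod.cong refl) (simp only: P'_sel[OF _ sel_\<Phi>[OF g]] T_def a_\<Phi>)
    also have "\<dots> = PConst (1 / real (order G)) * (\<Sum>\<alpha>\<in>?A. \<Prod>i\<in>{0..n}. at_vertex i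
          (P (\<rho> g i) (translate G \<sigma> g (copies_at (\<rho> g i)) (restrict \<alpha> (copies_at i)))))"
      by (simp add: prod.distrib sum_distrib_left PConst_power[symmetric] c(2) del: power_Suc)
    also have "\<dots> = PConst (1 / real (order G)) * p"
      by (simp only: poly_invariant_decomposition[OF p_inv g sos_cone_local[OF Psos] p])
    finally show ?thesis .
  qed
  \<comment> \<open>Index functions outside the image of \<open>\<Phi>\<close> drop out, and the
    rest splits into one share of \<open>p\<close> for each group element.\<close>
  have "(\<Sum>\<delta>\<in>copies \<rightarrow>\<^sub>E J. \<Prod>i\<in>{0..n}. P' i (restrict \<delta> (copies_at i))) =
      (\<Sum>\<delta>\<in>\<Phi> ` (carrier G \<times> ?A). \<Prod>i\<in>{0..n}. P' i (restrict \<delta> (copies_at i)))"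
    by (rule sum.mono_neutral_right) (use fin_J \<Phi>_image vanish in \<open>auto intro!: finite_PiE simp del: PiE_iff\<close>)
  also have "\<dots> = (\<Sum>g\<in>carrier G. \<Sum>\<alpha>\<in>?A. \<Prod>i\<in>{0..n}. P' i (restrict (\<Phi> (g, \<alpha>)) (copies_at i)))"
    by (simp add: sum.reindex[OF inj_\<Phi>] sum.cartesian_product split_beta)
  also have "\<dots> = (\<Sum>g\<in>carrier G. PConst (1 / real (order G)) * p)"
    by (intro sum.cong refl value_\<Phi>)
  also have "\<dots> = PConst (real (order G) * (1 / real (order G))) * p"
    by (simp only: sum_constant PConst_mult PConst_of_nat order_def mult.assoc)
  also have "\<dots> = p" using order_pos by simp
  finally have sum: "p = (\<Sum>\<delta>\<in>copies \<rightarrow>\<^sub>E J. \<Prod>i\<in>{0..n}. P' i (restrict \<delta> (copies_at i)))" ..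
  have "separable_decomposition n \<Omega> G \<rho> \<sigma> m (sos_cone m) p J P'"
    unfolding separable_decomposition_def decomposition_def
    by (intro conjI ballI fin_J sum P'_sos sos_cone_local[OF P'_sos] P'_inv)
  with card_J show ?thesis by blast
qed

end

text \<open>\<open>enat\<close> is well-ordered. An attained rank can be replaced by the size of an
  actual index set where the bound squares or multiplies it.\<close>

lemma Inf_enat_attained: "X \<noteq> {} \<Longrightarrow> Inf X \<in> X" for X :: "enat set"
  using wellorder_InfI[of _ X] by blast

theorem proposition39:
  fixes n :: nat and \<Omega> :: "nat set \<Rightarrow> nat" and G :: "('g, 'b) monoid_scheme"
    and \<rho> :: "'g \<Rightarrow> nat \<Rightarrow> nat" and \<sigma> :: "'g \<Rightarrow> facet_copy \<Rightarrow> facet_copy"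
    and m :: "nat \<Rightarrow> nat" and p :: rpoly
  assumes "complex_action n \<Omega> G \<rho> \<sigma>"
    and "\<forall>g \<in> carrier G. \<forall>i \<in> {0..n}. m (\<rho> g i) = m i"
    and "p \<in> global_polys n m"
  shows
    "(\<forall>C :: nat \<Rightarrow> rpoly set.
        (\<forall>i \<in> {0..n}. C i \<subseteq> local_polys m i \<and> poly_convex_cone (C i)) \<longrightarrow>
        (\<forall>g \<in> carrier G. \<forall>i \<in> {0..n}. C (\<rho> g i) = at_vertex (\<rho> g i) ` C i) \<longrightarrow>
        rank_action n \<Omega> G \<rho> \<sigma> m p \<le> sep_rank_action n \<Omega> G \<rho> \<sigma> m C p)
     \<and> rank_action n \<Omega> G \<rho> \<sigma> m p \<le> (sos_rank_action n \<Omega> G \<rho> \<sigma> m p)\<^sup>2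
     \<and> (factorizable n \<Omega> G \<rho> \<sigma> \<longrightarrow>
          sos_rank_action n \<Omega> G \<rho> \<sigma> m p \<le> sep_rank_action n \<Omega> G \<rho> \<sigma> m (sos_cone m) p)
     \<and> (complex_connected n \<Omega> \<and> free_action n \<Omega> G \<sigma> \<and> factorizable n \<Omega> G \<rho> \<sigma> \<and>
          poly_invariant G \<rho> p \<longrightarrow>
          sos_rank_action n \<Omega> G \<rho> \<sigma> m p \<le> enat (order G) * sep_rank n \<Omega> m (sos_cone m) p)"
proof -
  interpret complex_action n \<Omega> G \<rho> \<sigma> by fact
  have m: "\<And>g i. g \<in> carrier G \<Longrightarrow> i \<in> {0..n} \<Longrightarrow> m (\<rho> g i) = m i"
    using assms(2) by blast
  have rank_le: "rank_action n \<Omega> G \<rho> \<sigma> m p \<le> enat (card I)"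
    if "decomposition n \<Omega> G \<rho> \<sigma> m p I P" for I P
    unfolding rank_action_def using that by (intro Inf_lower) blast
  have sos_rank_le: "sos_rank_action n \<Omega> G \<rho> \<sigma> m p \<le> enat (card I)"
    if "separable_decomposition n \<Omega> G \<rho> \<sigma> m (sos_cone m) p I P" "factorizable n \<Omega> G \<rho> \<sigma>" for I P
    unfolding sos_rank_action_def using sos_decomposition_of_separable[OF m that]
    by (intro Inf_lower) blast
  have i: "rank_action n \<Omega> G \<rho> \<sigma> m p \<le> sep_rank_action n \<Omega> G \<rho> \<sigma> m C p" for C
    unfolding sep_rank_action_def separable_decomposition_def
    by (intro Inf_greatest) (use rank_le in blast)
  have ii: "rank_action n \<Omega> G \<rho> \<sigma> m p \<le> (sos_rank_action n \<Omega> G \<rho> \<sigma> m p)\<^sup>2"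
  proof (cases "{enat (card I) | I. \<exists>S q Q. sos_decomposition n \<Omega> G \<rho> \<sigma> m p S q I Q} = {}")
    \<comment> \<open>Without an sos decomposition the rank is infinite, and so is its
      square.\<close>
    case True
    then show ?thesis
      unfolding sos_rank_action_def True by (simp add: Inf_enat_def power2_eq_square)
  next
    case False
    then obtain I S q Q where I: "sos_decomposition n \<Omega> G \<rho> \<sigma> m p S q I Q"
      and rank: "sos_rank_action n \<Omega> G \<rho> \<sigma> m p = enat (card I)"
      unfolding sos_rank_action_def using Inf_enat_attained[OF False] by blast
    from decomposition_of_sos[OF I] obtain P where
      "decomposition n \<Omega> G \<rho> \<sigma> m p (prod_encode ` (I \<times> I)) P" ..
    from rank_le[OF this] show ?thesis
      by (simp add: rank card_image inj_prod_encode card_cartesian_product power2_eq_square)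
  qed
  have iii: "sos_rank_action n \<Omega> G \<rho> \<sigma> m p \<le> sep_rank_action n \<Omega> G \<rho> \<sigma> m (sos_cone m) p"
    if "factorizable n \<Omega> G \<rho> \<sigma>"
    unfolding sep_rank_action_def by (intro Inf_greatest) (use sos_rank_le that in blast)
  have iv: "sos_rank_action n \<Omega> G \<rho> \<sigma> m p \<le> enat (order G) * sep_rank n \<Omega> m (sos_cone m) p"
    if conn: "complex_connected n \<Omega>" "free_action n \<Omega> G \<sigma>" "poly_invariant G \<rho> p"
      and fact: "factorizable n \<Omega> G \<rho> \<sigma>"
  proof -
    let ?D = "separable_decomposition n \<Omega> (singleton_group ()) (\<lambda>_. \<lambda>i\<in>{0..n}. i)
        (\<lambda>_. \<lambda>f\<in>facet_copies n \<Omega>. f) m (sos_cone m) p"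
    show ?thesis
    proof (cases "{enat (card I) | I. \<exists>P. ?D I P} = {}")
      case True
      \<comment> \<open>In \<open>enat\<close> zero times infinity is zero, so the product is
        infinite only because the order is positive.\<close>
      have "order G > 0" using finite_group by (simp add: order_gt_0_iff_finite)
      then show ?thesis
        unfolding sep_rank_def sep_rank_action_def True by (simp add: Inf_enat_def imult_is_infinity zero_enat_def)
    next
      case False
      then obtain I P where D: "?D I P" and rank: "sep_rank n \<Omega> m (sos_cone m) p = enat (card I)"
        unfolding sep_rank_def sep_rank_action_def using Inf_enat_attained[OF False] by blast
      obtain J P' where "card J = order G * card I"
        "separable_decomposition n \<Omega> G \<rho> \<sigma> m (sos_cone m) p J P'"
        \<comment> \<open>The index functions do not depend on the group, so the decomposition for
          the trivial group supplies \<open>P\<close> over the same copies.\<close>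
        using separable_decomposition_of_invariant[OF m conn, of I P] D
        unfolding separable_decomposition_def[of n \<Omega> "singleton_group ()"]
          decomposition_def[of n \<Omega> "singleton_group ()"] by blast
      with sos_rank_le[of J P'] fact show ?thesis by (simp add: rank)
    qed
  qed
  show ?thesis using i ii iii iv by blast
qed

end
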